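(* Let $p$ be a prime, let $G$ be a finite abelian group, and let $\mathcal{M}=CM(G,X,q)$ be a $p$-valent regular Cayley map on $G$ (so $|X|=p$). Then $\mathcal{M}$ is either balanced or anti-balanced. Moreover: (1) If $\mathcal{M}$ is balanced, then $\mathcal{M}$ is isomorphic to $CM(\mathbb{Z}_2^n,X_1,q_1)$ for some elementary abelian $2$-group $\mathbb{Z}_2^n$, some $X_1\subset\mathbb{Z}_2^n$ and some cyclic permutation $q_1$ of $X_1$ such that (i) $X_1=\{A^i\mathbf{x}\mid 0\le i\le p-1\}$ for some $A\in \mathrm{GL}_n(2)$ and $\mathbf{x}\in\mathbb{Z}_2^n$ satisfying that $p$ is the smallest positive integer with $A^p=I$ and that $\langle \mathbf{x},A\mathbf{x},A^2\mathbf{x},\ldots,A^{p-1}\mathbf{x}\rangle=\mathbb{Z}_2^n$; (ii) $q_1(A^i\mathbf{x})=A^{i+1}\mathbf{x}$ for every $i\in\{0,1,\ldots,p-1\}$. (2) If $\mathcal{M}$ is anti-balanced, then $\mathcal{M}$ is isomorphic to $$CM(\mathbb{Z}_{2p},\,X_2=\{1,3,\ldots,2p-1\},\,q_2=(1\;\;3\;\ldots\;2p-1)).$$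
   Context: All graphs are finite, undirected, connected, without loops or multiple edges. An arc of a graph is an ordered pair of adjacent vertices. A map with underlying graph $\Gamma$ and arc set $D$ is a triple $\mathcal{M}=(D;R,L)$, where $R$ (the rotation) is a permutation of $D$ whose orbits are exactly the sets of arcs based at (i.e. with first coordinate) the same vertex, and $L$ is the involution of $D$ reversing each arc. A map isomorphism $\phi:(D_1;R_1,L_1)\to(D_2;R_2,L_2)$ is a graph isomorphism of the underlying graphs with $\phi R_1(x,y)=R_2\phi(x,y)$ for every arc $(x,y)\in D_1$; a map automorphism is an isomorphism from a map to itself. A map is regular if its automorphism group acts regularly on its arc set. Let $G$ be a finite group and $X=X^{-1}$ a subset of $G$ not containing the identity with $\langle X\rangle=G$. The Cayley graph $\mathrm{Cay}(G,X)$ has vertex set $G$, with $g,h$ adjacent iff $g^{-1}h\in X$. For a cyclic permutation $q$ of $X$ (a single cycle containing all of $X$), the Cayley map $CM(G,X,q)$ is the map with underlying graph $\mathrm{Cay}(G,X)$, rotation $R(g,gx)=(g,gq(x))$ and $L(g,gx)=(gx,g)$ for $g\in G$, $x\in X$. It is $k$-valent if $|X|=k$. For an integer $t$, $CM(G,X,q)$ is $t$-balanced if $q(x)^{-1}=q^t(x^{-1})$ for every $x\in X$; it is balanced if it is $1$-balanced and anti-balanced if it is $(-1)$-balanced. $\mathbb{Z}_m$ is the additive cyclic group of order $m$, and $\mathrm{GL}_n(2)$ is the group of invertible $n\times n$ matrices over the field with two elements, acting on $\mathbb{Z}_2^n$.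
   Formalization: Parts (1) and (2) are stated for p ≠ 2 only, since for p = 2 they fail: the triangle CM(Z_3,{1,2},(1 2)) is regular, balanced and anti-balanced but has 3 vertices; the dichotomy is kept for every prime p. *)

theory Defs
  imports
    "HOL-Algebra.Elementary_Groups"
    "HOL-Algebra.Multiplicative_Group"
    "HOL-Combinatorics.Orbits"
    "HOL-Combinatorics.Cycles"
    "HOL-Computational_Algebra.Primes"
    "HOL-Library.Z2"
    "Graph_Theory.Pair_Digraph"
    "Graph_Theory.Digraph_Component"
    "Jordan_Normal_Form.Matrix"
begin

section \<open>Maps\<close>

record 'v cmap =
  ugraph :: "'v pair_pre_digraph"
  rotation :: "'v \<times> 'v \<Rightarrow> 'v \<times> 'v"
  reversal :: "'v \<times> 'v \<Rightarrow> 'v \<times> 'v"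

abbreviation map_verts :: "'v cmap \<Rightarrow> 'v set" where
  "map_verts M \<equiv> pverts (ugraph M)"

abbreviation map_arcs :: "'v cmap \<Rightarrow> ('v \<times> 'v) set" where
  "map_arcs M \<equiv> parcs (ugraph M)"

text \<open>An undirected edge is represented by its two arcs, so \<^term>\<open>pair_graph\<close> is the
  library's notion of a finite undirected graph without loops or multiple edges.
  Both permutations fix everything that is not an arc.\<close>

locale combinatorial_map =
  fixes M :: "'v cmap"
  assumes simple: "pair_graph (ugraph M)"
    and connected: "Digraph_Component.connected (with_proj (ugraph M))"
    and rot_permutes: "rotation M permutes map_arcs M"
    and rot_orbits: "\<And>a. a \<in> map_arcs M \<Longrightarrow>
          orbit (rotation M) a = {b \<in> map_arcs M. fst b = fst a}"
    and rev_permutes: "reversal M permutes map_arcs M"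
    and rev_arc: "\<And>x y. (x, y) \<in> map_arcs M \<Longrightarrow> reversal M (x, y) = (y, x)"

definition map_iso :: "('v \<Rightarrow> 'w) \<Rightarrow> 'v cmap \<Rightarrow> 'w cmap \<Rightarrow> bool" where
  "map_iso \<phi> M N \<longleftrightarrow>
     bij_betw \<phi> (map_verts M) (map_verts N) \<and>
     (\<forall>x\<in>map_verts M. \<forall>y\<in>map_verts M. (x, y) \<in> map_arcs M \<longleftrightarrow> (\<phi> x, \<phi> y) \<in> map_arcs N) \<and>
     (\<forall>a\<in>map_arcs M. map_prod \<phi> \<phi> (rotation M a) = rotation N (map_prod \<phi> \<phi> a))"

definition map_isomorphic :: "'v cmap \<Rightarrow> 'w cmap \<Rightarrow> bool" where
  "map_isomorphic M N \<longleftrightarrow> (\<exists>\<phi>. map_iso \<phi> M N)"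

text \<open>Automorphisms fix everything outside the vertex set, so that each of them is
  represented by exactly one function.\<close>

definition map_automorphisms :: "'v cmap \<Rightarrow> ('v \<Rightarrow> 'v) set" where
  "map_automorphisms M = {\<phi>. \<phi> permutes map_verts M \<and> map_iso \<phi> M M}"

definition regular_map :: "'v cmap \<Rightarrow> bool" where
  "regular_map M \<longleftrightarrow>
     (\<forall>a\<in>map_arcs M. \<forall>b\<in>map_arcs M. \<exists>!\<phi>. \<phi> \<in> map_automorphisms M \<and> map_prod \<phi> \<phi> a = b)"


section \<open>Cayley maps\<close>

locale cayley_data = group G for G (structure) +
  fixes X :: "'a set" and q :: "'a \<Rightarrow> 'a"
  assumes finite_carrier: "finite (carrier G)"
    and X_subset: "X \<subseteq> carrier G"
    and X_inv: "(\<lambda>x. inv x) ` X = X"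
    and one_notin_X: "\<one> \<notin> X"
    and X_generates: "generate G X = carrier G"
    and q_permutes: "q permutes X"
    and q_cyclic: "cyclic_on q X"

definition cayley_graph :: "('a, 'm) monoid_scheme \<Rightarrow> 'a set \<Rightarrow> 'a pair_pre_digraph" where
  "cayley_graph G X =
     \<lparr> pverts = carrier G,
       parcs = {(g, h). g \<in> carrier G \<and> h \<in> carrier G \<and> inv\<^bsub>G\<^esub> g \<otimes>\<^bsub>G\<^esub> h \<in> X} \<rparr>"

definition cayley_map ::
  "('a, 'm) monoid_scheme \<Rightarrow> 'a set \<Rightarrow> ('a \<Rightarrow> 'a) \<Rightarrow> 'a cmap" where
  "cayley_map G X q =
     \<lparr> ugraph = cayley_graph G X,
       rotation = (\<lambda>(g, h). if (g, h) \<in> parcs (cayley_graph G X)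
                 then (g, g \<otimes>\<^bsub>G\<^esub> q (inv\<^bsub>G\<^esub> g \<otimes>\<^bsub>G\<^esub> h)) else (g, h)),
       reversal = (\<lambda>(g, h). if (g, h) \<in> parcs (cayley_graph G X) then (h, g) else (g, h)) \<rparr>"

definition perm_zpow :: "('a \<Rightarrow> 'a) \<Rightarrow> int \<Rightarrow> 'a \<Rightarrow> 'a" where
  "perm_zpow q t = (if t \<ge> 0 then q ^^ nat t else (Hilbert_Choice.inv q) ^^ nat (- t))"

definition t_balanced ::
  "int \<Rightarrow> ('a, 'm) monoid_scheme \<Rightarrow> 'a set \<Rightarrow> ('a \<Rightarrow> 'a) \<Rightarrow> bool" where
  "t_balanced t G X q \<longleftrightarrow> (\<forall>x\<in>X. inv\<^bsub>G\<^esub> (q x) = perm_zpow q t (inv\<^bsub>G\<^esub> x))"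

abbreviation balanced :: "('a, 'm) monoid_scheme \<Rightarrow> 'a set \<Rightarrow> ('a \<Rightarrow> 'a) \<Rightarrow> bool" where
  "balanced \<equiv> t_balanced 1"

abbreviation anti_balanced :: "('a, 'm) monoid_scheme \<Rightarrow> 'a set \<Rightarrow> ('a \<Rightarrow> 'a) \<Rightarrow> bool" where
  "anti_balanced \<equiv> t_balanced (- 1)"

lemma (in cayley_data) cayley_map_simps:
  assumes "g \<in> carrier G" "x \<in> X"
  shows "(g, g \<otimes> x) \<in> map_arcs (cayley_map G X q)"
    and "rotation (cayley_map G X q) (g, g \<otimes> x) = (g, g \<otimes> q x)"
    and "reversal (cayley_map G X q) (g, g \<otimes> x) = (g \<otimes> x, g)"
proof -
  have x: "x \<in> carrier G" using assms X_subset by auto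
  have e: "inv g \<otimes> (g \<otimes> x) = x" using assms x by (simp add: inv_solve_left')
  show "(g, g \<otimes> x) \<in> map_arcs (cayley_map G X q)"
    "rotation (cayley_map G X q) (g, g \<otimes> x) = (g, g \<otimes> q x)"
    "reversal (cayley_map G X q) (g, g \<otimes> x) = (g \<otimes> x, g)"
    using assms x e by (auto simp: cayley_map_def cayley_graph_def)
qed

lemma (in cayley_data) combinatorial_map_cayley_map:
  "combinatorial_map (cayley_map G X q)"
proof -
  let ?M = "cayley_map G X q"
  let ?D = "map_arcs ?M"
  have XG: "x \<in> carrier G" if "x \<in> X" for x using that X_subset by auto
  have qX: "q x \<in> X" if "x \<in> X" for x using that q_permutes permutes_in_image by metis
  have invX: "inv x \<in> X" if "x \<in> X" for x using that X_inv by blast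
  have V: "map_verts ?M = carrier G" by (simp add: cayley_map_def cayley_graph_def)
  have D: "?D = (\<lambda>(g, x). (g, g \<otimes> x)) ` (carrier G \<times> X)"
  proof (intro equalityI subsetI)
    fix a assume "a \<in> ?D"
    then obtain g h where "a = (g, h)" "g \<in> carrier G" "h \<in> carrier G" "inv g \<otimes> h \<in> X"
      by (auto simp: cayley_map_def cayley_graph_def)
    moreover from this have "h = g \<otimes> (inv g \<otimes> h)"
      by (simp add: m_assoc[symmetric])
    ultimately show "a \<in> (\<lambda>(g, x). (g, g \<otimes> x)) ` (carrier G \<times> X)"
      by (intro image_eqI[of _ _ "(g, inv g \<otimes> h)"]) auto
  qed (auto intro: cayley_map_simps)
  have DE: thesis if "a \<in> ?D" "\<And>g x. a = (g, g \<otimes> x) \<Longrightarrow> g \<in> carrier G \<Longrightarrow> x \<in> X \<Longrightarrow> thesis"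
    for a thesis using that unfolding D by auto
  have finX: "finite X" using X_subset finite_carrier finite_subset by blast
  have rot_out: "rotation ?M a = a" "reversal ?M a = a" if "a \<notin> ?D" for a
    using that by (auto simp: cayley_map_def split: prod.splits)
  have finD: "finite ?D" using finite_carrier finX D by simp
  have DV: "(g, h) \<in> ?D \<Longrightarrow> (h, g) \<in> ?D" for g h
  proof (erule DE)
    fix g' x assume *: "(g, h) = (g', g' \<otimes> x)" "g' \<in> carrier G" "x \<in> X"
    have "((g \<otimes> x), (g \<otimes> x) \<otimes> inv x) \<in> ?D"
      using * by (intro cayley_map_simps) (auto simp: XG invX)
    then show "(h, g) \<in> ?D" using * by (simp add: m_assoc XG)
  qed
  have graph: "pair_graph (ugraph ?M)"
  proof (unfold_locales)
    show "symmetric (with_proj (ugraph ?M))"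
      by (auto simp: symmetric_def intro!: symI DV)
    show "fst e \<noteq> snd e" if "e \<in> ?D" for e
      using that
    proof (rule DE)
      fix g x assume *: "e = (g, g \<otimes> x)" "g \<in> carrier G" "x \<in> X"
      have "g \<noteq> g \<otimes> x" using * one_notin_X XG by auto
      then show ?thesis using * by simp
    qed
  qed (use finite_carrier finD in \<open>auto simp: V XG elim!: DE\<close>)
  interpret gr: pair_graph "ugraph ?M" by (rule graph)
  have reach: "\<forall>g\<in>carrier G. reachable (with_proj (ugraph ?M)) g (g \<otimes> h)" if "h \<in> generate G X" for h
    using that
  proof (induction rule: generate.induct)
    case one then show ?case by (auto simp: V)
  next
    case (incl h) then show ?case
      by (auto intro!: gr.reachable_adjI cayley_map_simps)
  next
    case (inv h) then show ?case
      by (auto intro!: gr.reachable_adjI cayley_map_simps invX)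
  next
    case (eng h1 h2)
    then have h: "h1 \<in> carrier G" "h2 \<in> carrier G" by (simp_all add: X_generates)
    show ?case
    proof
      fix g assume g: "g \<in> carrier G"
      have "reachable (with_proj (ugraph ?M)) (g \<otimes> h1) ((g \<otimes> h1) \<otimes> h2)" using eng.IH h g by auto
      moreover have "reachable (with_proj (ugraph ?M)) g (g \<otimes> h1)" using eng.IH h g by auto
      ultimately show "reachable (with_proj (ugraph ?M)) g (g \<otimes> (h1 \<otimes> h2))"
        using gr.reachable_trans g h by (metis m_assoc)
    qed
  qed
  show ?thesis
  proof (rule combinatorial_map.intro)
    show "pair_graph (ugraph ?M)" by (rule graph)
    show "Digraph_Component.connected (with_proj (ugraph ?M))"
      unfolding connected_def
    proof (rule strongly_connectedI)
      show "verts (with_proj (mk_symmetric (with_proj (ugraph ?M)))) \<noteq> {}" using one_closed by (auto simp: V)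
      fix u v assume "u \<in> verts (with_proj (mk_symmetric (with_proj (ugraph ?M))))"
        "v \<in> verts (with_proj (mk_symmetric (with_proj (ugraph ?M))))"
      then have uv: "u \<in> carrier G" "v \<in> carrier G" by (auto simp: V)
      then have "reachable (with_proj (ugraph ?M)) u (u \<otimes> (inv u \<otimes> v))"
        using reach[of "inv u \<otimes> v"] by (simp add: X_generates)
      then show "reachable (with_proj (mk_symmetric (with_proj (ugraph ?M)))) u v"
        using uv by (intro gr.reachable_mk_symmetricI) (simp add: m_assoc[symmetric])
    qed
    have "inj_on (rotation ?M) ?D"
    proof (rule inj_onI, elim DE)
      fix a b g x h y
      assume *: "rotation ?M a = rotation ?M b" "a = (g, g \<otimes> x)" "g \<in> carrier G" "x \<in> X"
        "b = (h, h \<otimes> y)" "h \<in> carrier G" "y \<in> X"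
      then have "g = h" "g \<otimes> q x = g \<otimes> q y" by (auto simp: cayley_map_simps)
      then have "q x = q y" using * XG qX by (metis Units_eq Units_l_cancel)
      then have "x = y" using q_permutes permutes_inj by (metis injD)
      then show "a = b" using * \<open>g = h\<close> by simp
    qed
    moreover have "rotation ?M ` ?D \<subseteq> ?D"
      by (auto elim!: DE simp: cayley_map_simps qX)
    ultimately show "rotation ?M permutes ?D"
      by (intro bij_imp_permutes rot_out) (auto simp: bij_betw_def endo_inj_surj finD)
    have "reversal ?M (x, y) = (y, x)" if "(x, y) \<in> ?D" for x y
      using that by (auto simp: cayley_map_def)
    note rev = this
    then show "reversal ?M (x, y) = (y, x)" if "(x, y) \<in> ?D" for x y using that .
    have "inj_on (reversal ?M) ?D" by (rule inj_onI) (auto simp: rev)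
    moreover have "reversal ?M ` ?D \<subseteq> ?D"
      by (auto simp: rev intro: DV)
    ultimately show "reversal ?M permutes ?D"
      by (intro bij_imp_permutes rot_out) (auto simp: bij_betw_def endo_inj_surj finD)
    show "orbit (rotation ?M) a = {b \<in> ?D. fst b = fst a}" if "a \<in> ?D" for a
      using that
    proof (rule DE)
      fix g x assume *: "a = (g, g \<otimes> x)" "g \<in> carrier G" "x \<in> X"
      have o: "orbit q x = X" using q_cyclic * by (simp add: cyclic_on_alldef)
      have "(\<lambda>y. (g, g \<otimes> y)) ` orbit q x = orbit (rotation ?M) (g, g \<otimes> x)"
        by (rule orbit_inverse) (use * in \<open>auto simp: o cayley_map_simps\<close>)
      then have "orbit (rotation ?M) a = (\<lambda>y. (g, g \<otimes> y)) ` X" using * o by simp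
      also have "\<dots> = {b \<in> ?D. fst b = fst a}" using * by (auto simp: D)
      finally show ?thesis .
    qed
  qed
qed


section \<open>Elementary abelian 2-groups\<close>

abbreviation Z2_pow :: "nat \<Rightarrow> bit vec monoid" where
  "Z2_pow n \<equiv> monoid_vec TYPE(bit) n"

definition GL2 :: "nat \<Rightarrow> bit mat set" where
  "GL2 n = {A \<in> carrier_mat n n. invertible_mat A}"


section \<open>The anti-balanced example\<close>

definition odd_residues :: "nat \<Rightarrow> int set" where
  "odd_residues p = {k \<in> {0..<2 * int p}. odd k}"

definition odd_cycle :: "nat \<Rightarrow> int \<Rightarrow> int" where
  "odd_cycle p = cycle_of_list (map (\<lambda>i. 2 * int i + 1) [0..<p])"

lemma odd_cycle_eq:
  assumes "k < p" shows "odd_cycle p (2 * int k + 1) = (2 * int k + 3) mod (2 * int p)"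
proof -
  let ?cs = "map (\<lambda>i. 2 * int i + 1) [0..<p]"
  have "distinct ?cs" by (auto simp: distinct_map inj_on_def)
  from cyclic_rotation[OF this, of 1] have "map (odd_cycle p) ?cs = rotate1 ?cs"
    by (simp add: odd_cycle_def)
  then have "map (odd_cycle p) ?cs ! k = rotate1 ?cs ! k" by simp
  then have 1: "odd_cycle p (2 * int k + 1) = ?cs ! (Suc k mod p)"
    using assms by (simp add: nth_rotate1)
  have "\<dots> = 2 * int (Suc k mod p) + 1" using assms by (subst nth_map) auto
  also have "\<dots> = (2 * int k + 3) mod (2 * int p)"
  proof (cases "Suc k = p")
    case True
    then have e: "2 * int k + 3 = 1 + 2 * int p" by linarith
    have "(1 + 2 * int p) mod (2 * int p) = 1" using assms by (subst mod_add_self2) auto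
    then show ?thesis using True unfolding e by simp
  next
    case False
    then show ?thesis using assms by simp
  qed
  finally show ?thesis using 1 by simp
qed

lemma cayley_data_odd:
  assumes "p > 0" shows "cayley_data (integer_mod_group (2 * p)) (odd_residues p) (odd_cycle p)"
proof -
  let ?G = "integer_mod_group (2*p)"
  interpret group ?G by simp
  have C: "carrier ?G = {0..<2 * int p}" using assms by (simp add: carrier_integer_mod_group)
  have I: "inv\<^bsub>?G\<^esub> x = 2 * int p - x" if "x \<in> odd_residues p" for x
  proof -
    have "x \<noteq> 0" using that by (auto simp: odd_residues_def)
    then show ?thesis using that assms by (intro inv_equality) (auto simp: C odd_residues_def)
  qed
  have O: "odd_residues p = (\<lambda>i. 2 * int i + 1) ` {0..<p}"
  proof (intro equalityI subsetI)
    fix x assume "x \<in> odd_residues p"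
    then have "x = 2 * int (nat (x div 2)) + 1" "nat (x div 2) < p" by (auto simp: odd_residues_def elim!: oddE)
    then show "x \<in> (\<lambda>i. 2 * int i + 1) ` {0..<p}" by (intro image_eqI) auto
  qed (auto simp: odd_residues_def)
  show ?thesis
  proof
    show "finite (carrier ?G)" "odd_residues p \<subseteq> carrier ?G" by (auto simp: C odd_residues_def)
    show "(\<lambda>x. inv\<^bsub>?G\<^esub> x) ` odd_residues p = odd_residues p"
    proof (intro equalityI subsetI)
      fix x assume "x \<in> odd_residues p"
      then have "2 * int p - x \<in> odd_residues p"
        by (auto simp: odd_residues_def) (use \<open>x \<in> odd_residues p\<close> in \<open>auto simp: odd_residues_def elim!: oddE\<close>)
      then show "x \<in> (\<lambda>x. inv\<^bsub>?G\<^esub> x) ` odd_residues p"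
        by (intro image_eqI[of _ _ "2 * int p - x"]) (simp_all add: I)
    next
      fix x assume "x \<in> (\<lambda>x. inv\<^bsub>?G\<^esub> x) ` odd_residues p"
      then obtain y where "y \<in> odd_residues p" "x = 2 * int p - y" using I by auto
      then show "x \<in> odd_residues p" by (cases "y = 0") (auto simp: odd_residues_def)
    qed
    show "\<one>\<^bsub>?G\<^esub> \<notin> odd_residues p" by (simp add: odd_residues_def)
    have "int j \<in> generate ?G (odd_residues p)" if "j < 2 * p" for j
      using that
    proof (induction j)
      case 0 show ?case using generate.one[of ?G "odd_residues p"] by simp
    next
      case (Suc j)
      have "1 \<in> odd_residues p" using assms by (auto simp: odd_residues_def)
      from generate.eng[OF Suc.IH generate.incl[OF this]] Suc.prems show ?case
        by (simp add: ac_simps)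
    qed
    then have "carrier ?G \<subseteq> generate ?G (odd_residues p)"
      by (auto simp: C) (metis nat_less_iff int_nat_eq mult.commute nat_0_le of_nat_less_iff of_nat_mult of_nat_numeral)
    moreover have "generate ?G (odd_residues p) \<subseteq> carrier ?G"
      by (rule generate_incl) (auto simp: C odd_residues_def)
    ultimately show "generate ?G (odd_residues p) = carrier ?G" by blast
    show P: "odd_cycle p permutes odd_residues p"
      using cycle_permutes[of "map (\<lambda>i. 2 * int i + 1) [0..<p]"] O by (simp add: odd_cycle_def)
    have it: "(odd_cycle p ^^ j) 1 = 2 * int j + 1" if "j < p" for j
      using that by (induction j) (auto simp: odd_cycle_eq)
    have sub: "odd_residues p \<subseteq> orbit (odd_cycle p) 1"
    proof
      have "permutation (odd_cycle p)" by (simp add: odd_cycle_def permutation_of_cycle)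
      note od = orbit_altdef_permutation[OF this, of 1]
      fix x assume "x \<in> odd_residues p"
      then obtain j where "x = 2 * int j + 1" "j < p" unfolding O by auto
      then show "x \<in> orbit (odd_cycle p) 1" unfolding od using it[of j] by (intro CollectI exI[of _ j]) simp
    qed
    have one: "1 \<in> odd_residues p" using assms by (auto simp: odd_residues_def)
    moreover have "orbit (odd_cycle p) 1 \<subseteq> odd_residues p"
    proof
      fix x assume "x \<in> orbit (odd_cycle p) 1" then show "x \<in> odd_residues p"
        by induction (use one permutes_in_image[OF P] in auto)
    qed
    ultimately show "cyclic_on (odd_cycle p) (odd_residues p)" using sub by (auto simp: cyclic_on_def)
  qed
qed


section \<open>The triangle as a 2-valent Cayley map\<close>

text \<open>The \<open>m\<close>-cycle is a regular 2-valent Cayley map on \<open>\<int>\<^sub>m\<close> that is both balanced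
  and anti-balanced. For \<open>m = 3\<close> it is isomorphic neither to a Cayley map on an elementary
  abelian 2-group nor to the one on \<open>\<int>\<^sub>4\<close>, so the two descriptions up to
  isomorphism hold for odd \<open>p\<close> only.\<close>

abbreviation (input) "tri_G \<equiv> integer_mod_group 3"
abbreviation (input) "tri_X \<equiv> {1, 2::int}"
abbreviation (input) "tri_q \<equiv> Transposition.transpose (1::int) 2"

lemma triangle_carrier: "carrier tri_G = {0,1,2}" by (auto simp: carrier_integer_mod_group)

lemma triangle_inv: "inv\<^bsub>tri_G\<^esub> 0 = 0" "inv\<^bsub>tri_G\<^esub> 1 = 2" "inv\<^bsub>tri_G\<^esub> 2 = 1"
  by (rule group.inv_equality; simp add: triangle_carrier)+

lemma cayley_data_triangle: "cayley_data tri_G tri_X tri_q"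
proof -
  interpret group tri_G by simp
  show ?thesis
  proof
    show "finite (carrier tri_G)" by (simp add: triangle_carrier)
    show "tri_X \<subseteq> carrier tri_G" by (simp add: triangle_carrier)
    show "(\<lambda>x. inv\<^bsub>tri_G\<^esub> x) ` tri_X = tri_X" by (auto simp: triangle_inv)
    show "\<one>\<^bsub>tri_G\<^esub> \<notin> tri_X" by simp
    show "generate tri_G tri_X = carrier tri_G"
    proof
      show "generate tri_G tri_X \<subseteq> carrier tri_G" by (rule generate_incl) (simp add: triangle_carrier)
      show "carrier tri_G \<subseteq> generate tri_G tri_X"
        using generate.one[of tri_G tri_X] generate.incl[of _ tri_X tri_G] by (auto simp: triangle_carrier)
    qed
    show "tri_q permutes tri_X" by (rule permutes_swap_id) auto
    have "orbit tri_q 1 = {1,2}"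
    proof (intro equalityI subsetI)
      fix x assume "x \<in> orbit tri_q 1" then show "x \<in> {1,2}" by induction auto
    next
      have a: "2 \<in> orbit tri_q 1" using orbit.base[of tri_q 1] by simp
      have "1 \<in> orbit tri_q 1" using orbit.step[OF a] by simp
      with a show "x \<in> orbit tri_q 1" if "x \<in> {1,2}" for x using that by auto
    qed
    then show "cyclic_on tri_q tri_X" unfolding cyclic_on_def by auto
  qed
qed

lemma triangle_graph: "map_verts (cayley_map tri_G tri_X tri_q) = {0,1,2}" "map_arcs (cayley_map tri_G tri_X tri_q) = {(a,b). a \<in> {0,1,2} \<and> b \<in> {0,1,2} \<and> a \<noteq> b}"
  by (auto simp: cayley_map_def cayley_graph_def triangle_carrier triangle_inv)

lemma triangle_rotation: "(a,b) \<in> map_arcs (cayley_map tri_G tri_X tri_q) \<Longrightarrow> rotation (cayley_map tri_G tri_X tri_q) (a,b) = (a, 3 - a - b)"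
  unfolding triangle_graph by (auto simp: cayley_map_def cayley_graph_def triangle_carrier triangle_inv)

lemma triangle_automorphism: "\<phi> permutes {0,1,2} \<Longrightarrow> \<phi> \<in> map_automorphisms (cayley_map tri_G tri_X tri_q)"
proof -
  assume p: "\<phi> permutes {0,1,2}"
  have i: "\<phi> x = \<phi> y \<longleftrightarrow> x = y" for x y using permutes_inj[OF p] by (auto dest: injD)
  have r: "\<phi> x \<in> {0,1,2} \<longleftrightarrow> x \<in> {0,1,2}" for x using permutes_in_image[OF p] .
  have m: "\<phi> 0 \<in> {0,1,2}" "\<phi> 1 \<in> {0,1,2}" "\<phi> 2 \<in> {0,1,2}" using r by blast+
  have n: "\<phi> 0 \<noteq> \<phi> 1" "\<phi> 0 \<noteq> \<phi> 2" "\<phi> 1 \<noteq> \<phi> 2" by (simp_all add: i)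
  have s: "\<phi> 0 + \<phi> 1 + \<phi> 2 = 3" using m n by auto
  have rot: "\<phi> (3 - a - b) = 3 - \<phi> a - \<phi> b" if "a \<in> {0,1,2}" "b \<in> {0,1,2}" "a \<noteq> b" for a b
    using that s by auto
  have "map_iso \<phi> (cayley_map tri_G tri_X tri_q) (cayley_map tri_G tri_X tri_q)"
    unfolding map_iso_def
  proof (intro conjI ballI)
    show "bij_betw \<phi> (map_verts (cayley_map tri_G tri_X tri_q)) (map_verts (cayley_map tri_G tri_X tri_q))"
      using permutes_imp_bij[OF p] triangle_graph by simp
    fix a b show "(a, b) \<in> map_arcs (cayley_map tri_G tri_X tri_q) \<longleftrightarrow> (\<phi> a, \<phi> b) \<in> map_arcs (cayley_map tri_G tri_X tri_q)"
      unfolding triangle_graph using r i by blast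
  next
    fix a assume a: "a \<in> map_arcs (cayley_map tri_G tri_X tri_q)"
    obtain x y where xy: "a = (x,y)" by force
    have A: "x \<in> {0,1,2}" "y \<in> {0,1,2}" "x \<noteq> y" using a unfolding xy triangle_graph by auto
    have "(\<phi> x, \<phi> y) \<in> map_arcs (cayley_map tri_G tri_X tri_q)" unfolding triangle_graph using A r i by blast
    then show "map_prod \<phi> \<phi> (rotation (cayley_map tri_G tri_X tri_q) a) = rotation (cayley_map tri_G tri_X tri_q) (map_prod \<phi> \<phi> a)"
      using a rot[OF A] by (simp add: xy triangle_rotation)
  qed
  then show ?thesis using p by (simp add: map_automorphisms_def triangle_graph)
qed

lemma triangle_third: "z = 3 - x - y" if "x \<in> {0,1,2}" "y \<in> {0,1,2}" "z \<in> {0,1,2}" "x \<noteq> y" "z \<noteq> x" "z \<noteq> y" for x y z :: int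
  using that by auto

lemma regular_map_triangle: "regular_map (cayley_map tri_G tri_X tri_q)"
  unfolding regular_map_def
proof (intro ballI)
  fix a b assume ab: "a \<in> map_arcs (cayley_map tri_G tri_X tri_q)" "b \<in> map_arcs (cayley_map tri_G tri_X tri_q)"
  obtain x y u v where e: "a = (x,y)" "b = (u,v)" by (metis surj_pair)
  have A: "x \<in> {0,1,2}" "y \<in> {0,1,2}" "x \<noteq> y" "u \<in> {0,1,2}" "v \<in> {0,1,2}" "u \<noteq> v"
    using ab unfolding e triangle_graph by auto
  define f where "f z = (if z = x then u else if z = y then v else if z \<in> {0,1,2} then 3 - u - v else z)" for z
  have S: "{x, y, 3 - x - y} = {0,1,2}" if "x \<in> {0,1,2}" "y \<in> {0,1,2}" "x \<noteq> y" for x y :: int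
    using that by auto
  have nz: "3 - x - y \<noteq> x" "3 - x - y \<noteq> y" "3 - x - y \<in> {0,1,2}" using A(1-3) by auto
  have "f ` {x, y, 3 - x - y} = {u, v, 3 - u - v}" using A(3) nz by (auto simp: f_def)
  then have im: "f ` {0,1,2} = {0,1,2}" using S A by metis
  then have ff: "f ` {0,1,2} \<subseteq> {0,1,2}" "inj_on f {0,1,2}"
    by (simp, intro eq_card_imp_inj_on) (simp_all only: im finite.intros)
  then have fp: "f permutes {0,1,2}"
  proof (intro bij_imp_permutes)
    show "bij_betw f {0,1,2} {0,1,2}"
      using endo_inj_surj[OF _ ff] ff by (simp add: bij_betw_def)
    show "f z = z" if "z \<notin> {0,1,2}" for z using that A unfolding f_def by metis
  qed
  show "\<exists>!\<phi>. \<phi> \<in> map_automorphisms (cayley_map tri_G tri_X tri_q) \<and> map_prod \<phi> \<phi> a = b"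
  proof (intro ex1I conjI)
    show "f \<in> map_automorphisms (cayley_map tri_G tri_X tri_q)" by (rule triangle_automorphism[OF fp])
    show "map_prod f f a = b" using A by (simp add: e f_def)
    fix g assume g: "g \<in> map_automorphisms (cayley_map tri_G tri_X tri_q) \<and> map_prod g g a = b"
    then have gp: "g permutes {0,1,2}" by (simp add: map_automorphisms_def triangle_graph)
    have gx: "g x = u" "g y = v" using g by (auto simp: e)
    show "g = f"
    proof
      fix z show "g z = f z"
      proof (cases "z \<in> {0,1,2} \<and> z \<noteq> x \<and> z \<noteq> y")
        case True
        then have "g z \<in> {0,1,2}" using permutes_in_image[OF gp] by blast
        moreover have "g z \<noteq> u" "g z \<noteq> v" using True gx permutes_inj[OF gp] by (metis injD)+
        ultimately have "g z = 3 - u - v" using triangle_third A by blast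
        then show ?thesis using True by (simp add: f_def)
      next
        case False
        then show ?thesis using gx A permutes_not_in[OF gp, of z] by (auto simp: f_def)
      qed
    qed
  qed
qed

lemma balanced_triangle: "balanced tri_G tri_X tri_q" "anti_balanced tri_G tri_X tri_q"
  by (auto simp: t_balanced_def perm_zpow_def triangle_inv)

lemma triangle_not_iso_Z2_pow: "\<not> map_isomorphic (cayley_map tri_G tri_X tri_q) (cayley_map (Z2_pow n) X1 q1)"
  if "cayley_data (Z2_pow n) X1 q1"
proof
  assume "map_isomorphic (cayley_map tri_G tri_X tri_q) (cayley_map (Z2_pow n) X1 q1)"
  then obtain f where f: "bij_betw f {0,1,2::int} (carrier (Z2_pow n))"
    by (auto simp: map_isomorphic_def map_iso_def triangle_graph) (auto simp: cayley_map_def cayley_graph_def)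
  interpret Z: cayley_data "Z2_pow n" X1 q1 by (rule that)
  have c: "card (carrier (Z2_pow n)) = 3" using bij_betw_same_card[OF f] by simp
  obtain x where x: "x \<in> X1" using Z.q_cyclic by (auto simp: cyclic_on_def)
  have xc: "x \<in> carrier (Z2_pow n)" using x Z.X_subset by blast
  have xx: "x \<otimes>\<^bsub>Z2_pow n\<^esub> x = \<one>\<^bsub>Z2_pow n\<^esub>"
    using xc by (auto simp: monoid_vec_simps)
  have "x [^]\<^bsub>Z2_pow n\<^esub> (3::nat) = \<one>\<^bsub>Z2_pow n\<^esub>"
    using Z.pow_order_eq_1[OF xc] c by (simp add: order_def)
  then have "x = \<one>\<^bsub>Z2_pow n\<^esub>" using xx xc by (simp add: numeral_3_eq_3)
  then show False using x Z.one_notin_X by simp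
qed

lemma triangle_not_iso_Z4: "\<not> map_isomorphic (cayley_map tri_G tri_X tri_q) (cayley_map (integer_mod_group (2 * 2)) (odd_residues 2) (odd_cycle 2))"
proof
  assume "map_isomorphic (cayley_map tri_G tri_X tri_q) (cayley_map (integer_mod_group (2 * 2)) (odd_residues 2) (odd_cycle 2))"
  then obtain f where f: "bij_betw f {0,1,2::int} {0..<4::int}"
    by (auto simp: map_isomorphic_def map_iso_def triangle_graph) (auto simp: cayley_map_def cayley_graph_def carrier_integer_mod_group)
  show False using bij_betw_same_card[OF f] by simp
qed

end

(* The automorphism phi that fixes the identity and rotates X by q satisfies
   phi^k (g h) = phi^k g * phi^(sigma_g k) h, where every sigma_g is a permutation of Z_p fixing 0.
   As G is abelian the sigma_g commute, and they are closed under sigma |-> sigma (k + j) - sigma j.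
   For p prime this forces every sigma_g to be additive, so sigma_(phi g) = sigma_g, and sigma_x is
   multiplication by one and the same t for all x in X. Inverting twice gives t^2 = 1, that is,
   t = 1 or t = -1.
   For odd p the set X contains an involution. If t = 1, then phi is a group automorphism, hence X
   consists of involutions, G is elementary abelian and phi is a matrix. If t = -1, commutativity
   makes q a translation x |-> d x on X, and a square root w of d in X generates G. *)

theory Submission
  imports Defs "HOL-Number_Theory.Cong"
begin

section \<open>Commuting permutations of a prime cyclic group\<close>

text \<open>The obstacle is that the exponent in phi (g h) = phi g * phi^k h depends on g, so phi is
  not a homomorphism and says little about G directly. The exponents themselves are more tractable:
  they move only p points, and commutativity of G becomes commutativity of a point stabilizer in a
  permutation group of prime degree. Primality enters because the multiples of one nonzero residue
  are all residues: a permutation that commutes with a nonzero translation and fixes 0 is trivial.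
  This excludes nonzero fixed points of a nontrivial sigma_g, and from there additivity is a
  counting argument. Additivity is the right target because the twist of sigma_g by j turns out to
  be sigma_(phi^j g): an additive sigma_g equals its own twists, so it does not change along the
  phi-orbit of g, and X is one such orbit. Oddness of p serves two purposes: parity yields an
  involution x0 in X, and 2 becomes invertible on exponents. With m = (p + 1) / 2 one has q^(2 m) =
  q; this produces d from q^2, and w = q^m x0 as the square root of d.\<close>

lemma cong_inj_imp_surj:
  fixes f :: "int \<Rightarrow> int" and m :: int
  assumes "m > 0" and inj: "\<And>k l. [f k = f l] (mod m) \<Longrightarrow> [k = l] (mod m)"
  obtains k where "[f k = u] (mod m)"
proof -
  let ?h = "\<lambda>k. f k mod m"
  have "inj_on ?h {0..<m}"
  proof (rule inj_onI)
    fix k l assume kl: "k \<in> {0..<m}" "l \<in> {0..<m}" "f k mod m = f l mod m"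
    then have "[f k = f l] (mod m)" by (simp only: cong_def)
    then have "[k = l] (mod m)" by (rule inj)
    then show "k = l" using kl(1,2) by (simp add: cong_def)
  qed
  moreover have "?h ` {0..<m} \<subseteq> {0..<m}"
    using \<open>m > 0\<close> by auto
  ultimately have "?h ` {0..<m} = {0..<m}"
    by (intro endo_inj_surj) auto
  moreover have "u mod m \<in> {0..<m}"
    using \<open>m > 0\<close> by auto
  ultimately have "u mod m \<in> ?h ` {0..<m}"
    by simp
  then obtain k where k: "f k mod m = u mod m"
    by fastforce
  show ?thesis
    by (rule that[of k]) (simp add: cong_def k)
qed

text \<open>A natural multiplier lets facts about multiples of \<open>j\<close> be proved by
  induction and then hold at every residue.\<close>

lemma cong_mult_solve:
  fixes j k m :: int
  assumes "prime m" "\<not> m dvd j"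
  obtains n :: nat where "[int n * j = k] (mod m)"
proof -
  have "coprime j m"
    using assms prime_imp_coprime coprime_commute by blast
  then obtain x where x: "[j * x = 1] (mod m)"
    using cong_solve_coprime_int by blast
  have "m > 0" using assms(1) prime_gt_0_int by blast
  have "[int (nat ((x * k) mod m)) * j = (x * k) * j] (mod m)"
    using \<open>m > 0\<close> by (simp add: cong_def mod_mult_left_eq)
  also have "(x * k) * j = (j * x) * k" by (simp add: ac_simps)
  also have "[\<dots> = 1 * k] (mod m)" using x by (rule cong_scalar_right)
  finally show ?thesis using that[of "nat ((x * k) mod m)"] by simp
qed

text \<open>Modulo \<open>m\<close>, \<^term>\<open>S\<close> is an abelian permutation group of \<open>\<int>\<^sub>m\<close> fixing \<open>0\<close>, and \<open>twist\<close> says that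
  multiplying it with the translations yields a group, in which \<^term>\<open>S\<close> is the stabilizer of \<open>0\<close>.\<close>

locale twisted_permutations =
  fixes S :: "(int \<Rightarrow> int) set" and m :: int
  assumes prime_m: "prime m"
    and cong_iff: "\<sigma> \<in> S \<Longrightarrow> [\<sigma> k = \<sigma> l] (mod m) \<longleftrightarrow> [k = l] (mod m)"
    and zero: "\<sigma> \<in> S \<Longrightarrow> [\<sigma> 0 = 0] (mod m)"
    and comm: "\<sigma> \<in> S \<Longrightarrow> \<tau> \<in> S \<Longrightarrow> [\<sigma> (\<tau> k) = \<tau> (\<sigma> k)] (mod m)"
    and quotient: "\<sigma> \<in> S \<Longrightarrow> \<tau> \<in> S \<Longrightarrow> \<exists>\<rho>\<in>S. \<forall>k. [\<rho> (\<sigma> k) = \<tau> k] (mod m)"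
    and twist: "\<sigma> \<in> S \<Longrightarrow> \<exists>\<sigma>'\<in>S. \<forall>k. [\<sigma> (k + j) = \<sigma>' k + \<sigma> j] (mod m)"
begin

lemma m_pos: "m > 0"
  using prime_m prime_gt_0_int by blast

lemma twistE:
  assumes "\<sigma> \<in> S"
  obtains \<sigma>' where "\<sigma>' \<in> S" "\<And>k. [\<sigma> (k + j) = \<sigma>' k + \<sigma> j] (mod m)"
  using twist[OF assms] by blast

text \<open>Both \<^term>\<open>S\<close> and its conjugate by the translation by \<open>j\<close> centralize \<open>\<sigma>\<close>; for each \<open>\<eta>\<close> these
  two together produce a translation by \<open>\<eta> (- j) + j\<close> that centralizes \<open>\<sigma>\<close>.\<close>

lemma fixed_point_shift:
  assumes s: "\<sigma> \<in> S" and j: "[\<sigma> j = j] (mod m)" and h: "\<eta> \<in> S"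
  shows "[\<sigma> (u + (\<eta> (- j) + j)) = \<sigma> u + (\<eta> (- j) + j)] (mod m)"
proof -
  obtain \<sigma>' where s': "\<sigma>' \<in> S" "\<And>k. [\<sigma> (k + j) = \<sigma>' k + \<sigma> j] (mod m)"
    using twistE[OF s] by blast
  obtain \<eta>' where h': "\<eta>' \<in> S" "\<And>k. [\<eta> (k + - j) = \<eta>' k + \<eta> (- j)] (mod m)"
    using twistE[OF h, of "- j"] by blast
  obtain k where k: "[\<eta>' k = u] (mod m)"
    using cong_inj_imp_surj[OF m_pos, of \<eta>' u] cong_iff[OF h'(1)] by blast
  \<comment> \<open>Because \<open>j\<close> is fixed, the twist \<open>\<sigma>'\<close> is the
    conjugate of \<open>\<sigma>\<close> by the translation by \<open>j\<close>. It commutes with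
    \<open>\<eta>\<close>, so \<open>\<sigma>\<close> commutes with k |->
    \<open>\<eta> (k - j) + j\<close>, which is \<open>\<eta>'\<close> followed by the translation
    in question.\<close>
  have s'': "[\<sigma>' l + j = \<sigma> (l + j)] (mod m)" for l
    using s'(2)[of l] j by (metis cong_add_lcancel cong_sym cong_trans)
  have "[u + (\<eta> (- j) + j) = (\<eta>' k + \<eta> (- j)) + j] (mod m)"
    using cong_add[OF cong_sym[OF k] cong_refl[of "\<eta> (- j) + j"]] by (simp add: ac_simps)
  also have "[(\<eta>' k + \<eta> (- j)) + j = \<eta> (k - j) + j] (mod m)"
    using h'(2)[of k] by (intro cong_add) (auto simp: cong_sym)
  finally have "[\<sigma> (u + (\<eta> (- j) + j)) = \<sigma> (\<eta> (k - j) + j)] (mod m)"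
    using cong_iff[OF s] by blast
  also have "[\<sigma> (\<eta> (k - j) + j) = \<sigma>' (\<eta> (k - j)) + j] (mod m)"
    using s'' cong_sym by blast
  also have "[\<sigma>' (\<eta> (k - j)) + j = \<eta> (\<sigma>' (k - j)) + j] (mod m)"
    using comm[OF s'(1) h] by (intro cong_add) auto
  also have "[\<eta> (\<sigma>' (k - j)) + j = \<eta> (\<sigma> k + - j) + j] (mod m)"
  proof -
    have "[\<sigma>' (k - j) + j + - j = \<sigma> k + - j] (mod m)"
      using s''[of "k - j"] by (intro cong_add) auto
    then show ?thesis using cong_iff[OF h] by (intro cong_add) auto
  qed
  also have "[\<eta> (\<sigma> k + - j) + j = (\<eta>' (\<sigma> k) + \<eta> (- j)) + j] (mod m)"
    using h'(2)[of "\<sigma> k"] by (intro cong_add) auto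
  also have "[(\<eta>' (\<sigma> k) + \<eta> (- j)) + j = (\<sigma> u + \<eta> (- j)) + j] (mod m)"
  proof -
    have "[\<eta>' (\<sigma> k) = \<sigma> u] (mod m)"
      using comm[OF h'(1) s] cong_iff[OF s] k cong_trans by blast
    then show ?thesis by (intro cong_add) auto
  qed
  finally show ?thesis by (simp add: ac_simps)
qed

text \<open>If every permutation fixes \<open>- j\<close>, twisting by \<open>- j\<close> spreads
  this to all multiples of \<open>- j\<close>, and all of \<open>S\<close> is trivial. Otherwise
  some \<open>\<eta>\<close> moves \<open>- j\<close>, and by \<open>fixed_point_shift\<close> the
  permutation \<open>\<sigma>\<close> commutes with a nonzero translation, so it fixes every
  multiple of the shift.\<close>

lemma fixed_point_cases:
  assumes s: "\<sigma> \<in> S" and j: "[\<sigma> j = j] (mod m)" "\<not> m dvd j"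
  shows "(\<forall>k. [\<sigma> k = k] (mod m)) \<or> (\<forall>\<tau>\<in>S. \<forall>k. [\<tau> k = k] (mod m))"
proof (cases "\<forall>\<eta>\<in>S. [\<eta> (- j) = - j] (mod m)")
  case True
  \<comment> \<open>\<open>\<eta>\<close> stays arbitrary because the twist in the induction step
    replaces it by another element of \<open>S\<close>.\<close>
  have mult: "[\<eta> (int n * - j) = int n * - j] (mod m)" if "\<eta> \<in> S" for \<eta> n
    using that
  proof (induction n arbitrary: \<eta>)
    case 0 then show ?case using zero by simp
  next
    case (Suc n)
    obtain \<eta>' where h': "\<eta>' \<in> S" "\<And>k. [\<eta> (k + - j) = \<eta>' k + \<eta> (- j)] (mod m)"
      using twistE[OF Suc.prems, of "- j"] by blast
    have "[\<eta> (int n * - j + - j) = \<eta>' (int n * - j) + \<eta> (- j)] (mod m)"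
      by (rule h'(2))
    also have "[\<eta>' (int n * - j) + \<eta> (- j) = int n * - j + - j] (mod m)"
      using Suc.IH[OF h'(1)] True Suc.prems by (intro cong_add) auto
    finally show ?case by (simp add: algebra_simps)
  qed
  have "[\<tau> k = k] (mod m)" if "\<tau> \<in> S" for \<tau> k
  proof -
    obtain n where n: "[int n * - j = k] (mod m)"
      using cong_mult_solve[OF prime_m, of "- j" k] j(2) by auto
    then have "[\<tau> k = \<tau> (int n * - j)] (mod m)"
      using cong_iff[OF that] cong_sym by blast
    then show ?thesis
      using mult[OF that, of n] n cong_trans by blast
  qed
  then show ?thesis by blast
next
  case False
  then obtain \<eta> where h: "\<eta> \<in> S" "\<not> [\<eta> (- j) = - j] (mod m)" by blast
  define c where "c = \<eta> (- j) + j"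
  have c: "\<not> m dvd c"
    using h(2) by (simp add: c_def cong_iff_dvd_diff)
  have mult: "[\<sigma> (int n * c) = int n * c] (mod m)" for n
  proof (induction n)
    case 0 then show ?case using zero[OF s] by simp
  next
    case (Suc n)
    have "[\<sigma> (int n * c + c) = \<sigma> (int n * c) + c] (mod m)"
      unfolding c_def by (rule fixed_point_shift[OF s j(1) h(1)])
    also have "[\<sigma> (int n * c) + c = int n * c + c] (mod m)"
      using Suc.IH by (intro cong_add) auto
    finally show ?case by (simp add: algebra_simps)
  qed
  have "[\<sigma> k = k] (mod m)" for k
  proof -
    obtain n where n: "[int n * c = k] (mod m)"
      using cong_mult_solve[OF prime_m c, of k] by auto
    then have "[\<sigma> k = \<sigma> (int n * c)] (mod m)"
      using cong_iff[OF s] cong_sym by blast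
    then show ?thesis
      using mult[of n] n cong_trans by blast
  qed
  then show ?thesis by blast
qed

text \<open>The quotient \<open>\<rho>\<close> taking \<open>\<sigma>\<close> to
  \<open>\<tau>\<close> fixes \<open>\<sigma> j\<close>, which is nonzero because \<open>j\<close>
  is; \<open>fixed_point_cases\<close> leaves only the trivial \<open>\<rho>\<close>.\<close>

lemma semiregular:
  assumes nontriv: "\<not> (\<forall>\<tau>\<in>S. \<forall>k. [\<tau> k = k] (mod m))"
    and st: "\<sigma> \<in> S" "\<tau> \<in> S" and j: "[\<sigma> j = \<tau> j] (mod m)" "\<not> m dvd j"
  shows "[\<sigma> k = \<tau> k] (mod m)"
proof -
  obtain \<rho> where r: "\<rho> \<in> S" "\<And>k. [\<rho> (\<sigma> k) = \<tau> k] (mod m)"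
    using quotient[OF st] by blast
  have "[\<rho> (\<sigma> j) = \<sigma> j] (mod m)"
    using r(2) j(1) cong_sym cong_trans by blast
  moreover have "\<not> m dvd \<sigma> j"
  proof
    assume "m dvd \<sigma> j"
    then have "[\<sigma> j = \<sigma> 0] (mod m)"
      using zero[OF st(1)] cong_trans cong_sym unfolding cong_0_iff[symmetric] by blast
    then show False using cong_iff[OF st(1)] j(2) by (simp add: cong_0_iff)
  qed
  ultimately have "[\<rho> (\<sigma> k) = \<sigma> k] (mod m)"
    using fixed_point_cases[OF r(1)] nontriv by blast
  then show ?thesis using r(2) cong_sym cong_trans by blast
qed

text \<open>If the twist \<open>\<tau>\<close> of \<open>\<sigma>\<close> by \<open>j\<close> differs from \<open>\<sigma>\<close>, then by semiregularity \<open>k \<mapsto> \<tau> k - \<sigma> k\<close> is a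
  bijection modulo \<open>m\<close>; a point where it takes the value \<open>- \<sigma> j\<close> contradicts the injectivity of \<open>\<sigma>\<close>.\<close>

lemma additive:
  assumes s: "\<sigma> \<in> S"
  shows "[\<sigma> (k + j) = \<sigma> k + \<sigma> j] (mod m)"
proof (cases "\<forall>\<tau>\<in>S. \<forall>k. [\<tau> k = k] (mod m)")
  case True
  then have "[\<sigma> (k + j) = k + j] (mod m)" "[\<sigma> k + \<sigma> j = k + j] (mod m)"
    using s by (auto intro: cong_add)
  then show ?thesis by (metis cong_sym cong_trans)
next
  case nontriv: False
  show ?thesis
  proof (cases "m dvd j")
    case True
    then have j: "[j = 0] (mod m)" by (simp add: cong_0_iff)
    have "[\<sigma> (k + j) = \<sigma> (k + 0)] (mod m)"
      using cong_iff[OF s] j by (simp add: cong_add_lcancel_0)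
    moreover have "[\<sigma> k + \<sigma> j = \<sigma> k + 0] (mod m)"
      using cong_trans[OF iffD2[OF cong_iff[OF s] j] zero[OF s]] by (intro cong_add) auto
    ultimately show ?thesis by (metis add.right_neutral cong_sym cong_trans)
  next
    case j: False
    obtain \<tau> where t: "\<tau> \<in> S" "\<And>k. [\<sigma> (k + j) = \<tau> k + \<sigma> j] (mod m)"
      using twistE[OF s] by blast
    have "[\<tau> k = \<sigma> k] (mod m)" for k
    proof (rule ccontr)
      assume ne: "\<not> [\<tau> k = \<sigma> k] (mod m)"
      \<comment> \<open>If the difference takes the same value at \<open>a\<close> and
        \<open>b\<close>, the twists of \<open>\<sigma>\<close> and \<open>\<tau>\<close> by
        \<open>a\<close> agree at the nonzero residue \<open>b - a\<close>, hence everywhere. Then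
        the difference is constant, and zero since it vanishes at 0, against the choice of
        \<open>k\<close>.\<close>
      have inj: "[a = b] (mod m)" if ab: "[\<tau> a - \<sigma> a = \<tau> b - \<sigma> b] (mod m)" for a b
      proof (rule ccontr)
        assume "\<not> [a = b] (mod m)"
        then have d: "\<not> m dvd (b - a)"
          using cong_iff_dvd_diff cong_sym by blast
        obtain \<sigma>' where s': "\<sigma>' \<in> S" "\<And>k. [\<sigma> (k + a) = \<sigma>' k + \<sigma> a] (mod m)"
          using twistE[OF s] by blast
        obtain \<tau>' where t': "\<tau>' \<in> S" "\<And>k. [\<tau> (k + a) = \<tau>' k + \<tau> a] (mod m)"
          using twistE[OF t(1)] by blast
        have "[\<sigma>' (b - a) = \<sigma> b - \<sigma> a] (mod m)"
          using s'(2)[of "b - a"] by (simp add: cong_iff_dvd_diff dvd_diff_commute algebra_simps)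
        moreover have "[\<tau>' (b - a) = \<tau> b - \<tau> a] (mod m)"
          using t'(2)[of "b - a"] by (simp add: cong_iff_dvd_diff dvd_diff_commute algebra_simps)
        moreover have "[\<sigma> b - \<sigma> a = \<tau> b - \<tau> a] (mod m)"
          using ab by (simp add: cong_iff_dvd_diff algebra_simps)
        ultimately have "[\<sigma>' (b - a) = \<tau>' (b - a)] (mod m)"
          using cong_sym cong_trans by blast
        then have eq: "[\<sigma>' l = \<tau>' l] (mod m)" for l
          using semiregular[OF nontriv s'(1) t'(1)] d by blast
        have diff: "[\<sigma> l - \<sigma> a = \<tau> l - \<tau> a] (mod m)" for l
        proof -
          have "[\<sigma> l - \<sigma> a = \<sigma>' (l - a)] (mod m)"
            using s'(2)[of "l - a"] by (simp add: cong_iff_dvd_diff algebra_simps)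
          moreover have "[\<tau> l - \<tau> a = \<tau>' (l - a)] (mod m)"
            using t'(2)[of "l - a"] by (simp add: cong_iff_dvd_diff algebra_simps)
          ultimately show ?thesis using eq cong_sym cong_trans by blast
        qed
        have "[\<tau> 0 - \<sigma> 0 = 0 - 0] (mod m)"
          using zero[OF s] zero[OF t(1)] by (rule cong_diff[rotated])
        moreover have "[\<tau> k - \<sigma> k = \<tau> 0 - \<sigma> 0] (mod m)"
        proof -
          have "[(\<sigma> 0 - \<sigma> a) - (\<sigma> k - \<sigma> a) = (\<tau> 0 - \<tau> a) - (\<tau> k - \<tau> a)] (mod m)"
            using cong_diff[OF diff[of 0] diff[of k]] .
          then show ?thesis by (simp add: cong_iff_dvd_diff algebra_simps)
        qed
        ultimately have "[\<tau> k - \<sigma> k = 0 - 0] (mod m)" by (rule cong_trans[rotated])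
        then show False using ne by (simp add: cong_iff_dvd_diff)
      qed
      obtain l where l: "[\<tau> l - \<sigma> l = - \<sigma> j] (mod m)"
        using cong_inj_imp_surj[OF m_pos, of "\<lambda>l. \<tau> l - \<sigma> l"] inj by blast
      have "[\<tau> l + \<sigma> j = \<sigma> l] (mod m)"
        using l by (simp add: cong_iff_dvd_diff algebra_simps)
      then have "[\<sigma> (l + j) = \<sigma> l] (mod m)" using t(2) cong_trans by blast
      then have "[l + j = l] (mod m)" using cong_iff[OF s] by blast
      then show False using j by (simp add: cong_iff_dvd_diff)
    qed
    then have "[\<tau> k + \<sigma> j = \<sigma> k + \<sigma> j] (mod m)" by (intro cong_add) auto
    then show ?thesis using t(2) cong_trans by blast
  qed
qed

end

section \<open>The rotation automorphism of a regular Cayley map\<close>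

text \<open>\<open>map_iso\<close> controls adjacency between vertices only; for a bare record it
  must be said that arcs end in vertices.\<close>

lemma map_iso_comp:
  assumes "map_iso \<phi> M N" "map_iso \<psi> N P"
    and "\<And>a. a \<in> map_arcs M \<Longrightarrow> fst a \<in> map_verts M \<and> snd a \<in> map_verts M"
  shows "map_iso (\<psi> \<circ> \<phi>) M P"
proof -
  have V: "\<phi> x \<in> map_verts N" if "x \<in> map_verts M" for x
    using assms(1) that unfolding map_iso_def by (metis bij_betwE)
  have A: "map_prod \<phi> \<phi> a \<in> map_arcs N" if "a \<in> map_arcs M" for a
    using assms(1) assms(3)[OF that] that unfolding map_iso_def by (cases a) auto
  show ?thesis
    unfolding map_iso_def
  proof (intro conjI ballI)
    show "bij_betw (\<psi> \<circ> \<phi>) (map_verts M) (map_verts P)"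
      using assms(1,2) unfolding map_iso_def by (blast intro: bij_betw_trans)
    show "(x, y) \<in> map_arcs M \<longleftrightarrow> ((\<psi> \<circ> \<phi>) x, (\<psi> \<circ> \<phi>) y) \<in> map_arcs P"
      if "x \<in> map_verts M" "y \<in> map_verts M" for x y
      using assms(1,2) that V unfolding map_iso_def by simp
    fix a assume a: "a \<in> map_arcs M"
    have "map_prod (\<psi> \<circ> \<phi>) (\<psi> \<circ> \<phi>) (rotation M a) = map_prod \<psi> \<psi> (map_prod \<phi> \<phi> (rotation M a))"
      by (cases "rotation M a") simp
    also have "\<dots> = map_prod \<psi> \<psi> (rotation N (map_prod \<phi> \<phi> a))"
      using assms(1) a unfolding map_iso_def by simp
    also have "\<dots> = rotation P (map_prod \<psi> \<psi> (map_prod \<phi> \<phi> a))"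
      using assms(2) A[OF a] unfolding map_iso_def by simp
    finally show "map_prod (\<psi> \<circ> \<phi>) (\<psi> \<circ> \<phi>) (rotation M a) = rotation P (map_prod (\<psi> \<circ> \<phi>) (\<psi> \<circ> \<phi>) a)"
      by (cases a) simp
  qed
qed

context cayley_data
begin

abbreviation CM where "CM \<equiv> cayley_map G X q"

lemma map_verts_CM [simp]: "map_verts CM = carrier G"
  by (simp add: cayley_map_def cayley_graph_def)

lemma map_arcs_CM_iff: "(g, h) \<in> map_arcs CM \<longleftrightarrow> g \<in> carrier G \<and> h \<in> carrier G \<and> inv g \<otimes> h \<in> X"
  by (simp add: cayley_map_def cayley_graph_def)

lemma X_carrier: "x \<in> X \<Longrightarrow> x \<in> carrier G"
  using X_subset by blast

lemma inv_X: "x \<in> X \<Longrightarrow> inv x \<in> X"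
  using X_inv by blast

lemma q_X: "x \<in> X \<Longrightarrow> q x \<in> X"
  using permutes_in_image[OF q_permutes] by blast

lemma funpow_q_X: "x \<in> X \<Longrightarrow> (q ^^ k) x \<in> X"
  by (induction k) (simp_all add: permutes_in_image[OF q_permutes])

lemma rotation_CM:
  "g \<in> carrier G \<Longrightarrow> h \<in> carrier G \<Longrightarrow> inv g \<otimes> h \<in> X \<Longrightarrow>
     rotation CM (g, h) = (g, g \<otimes> q (inv g \<otimes> h))"
  by (simp add: cayley_map_def cayley_graph_def)

lemma rotation_CM_one: "x \<in> X \<Longrightarrow> rotation CM (\<one>, x) = (\<one>, q x)"
  using rotation_CM[of \<one> x] X_carrier permutes_in_image[OF q_permutes] by simp

lemma orbit_q: "x \<in> X \<Longrightarrow> orbit q x = X"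
  using q_cyclic unfolding cyclic_on_alldef by blast

lemma X_funpow_q:
  assumes "x \<in> X" "y \<in> X"
  obtains k where "y = (q ^^ k) x"
proof -
  have "y \<in> orbit q x" using assms orbit_q by simp
  then show thesis using that by (auto simp: orbit_altdef)
qed

text \<open>The first return time of \<open>x\<close> is a period of \<open>q\<close> at
  \<open>x\<close>, and the points met before the return are distinct and exhaust the orbit, which
  is X.\<close>

lemma funpow_q_eq_iff:
  assumes x: "x \<in> X"
  shows "(q ^^ a) x = (q ^^ b) x \<longleftrightarrow> [a = b] (mod card X)"
proof -
  define n where "n = funpow_dist1 q x x"
  have xo: "x \<in> orbit q x" using x orbit_q by simp
  have n: "(q ^^ n) x = x" "n > 0"
    using funpow_dist1_prop[OF xo] by (simp_all add: n_def)
  have "X = (\<lambda>k. (q ^^ k) x) ` {0..<n}"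
    using orbit_conv_funpow_dist1[OF xo] orbit_q[OF x] by (simp add: n_def)
  moreover have inj: "inj_on (\<lambda>k. (q ^^ k) x) {0..<n}"
    using inj_on_funpow_dist1[OF xo] by (simp add: n_def)
  ultimately have c: "card X = n" by (simp add: card_image)
  have m: "(q ^^ k) x = (q ^^ (k mod n)) x" for k
    using funpow_mod_eq[OF n(1), of k] by simp
  show ?thesis
  proof
    assume "(q ^^ a) x = (q ^^ b) x"
    then have "(q ^^ (a mod n)) x = (q ^^ (b mod n)) x" using m by metis
    then have "a mod n = b mod n" using inj n(2) by (auto simp: inj_on_def)
    then show "[a = b] (mod card X)" by (simp add: c cong_def)
  next
    assume "[a = b] (mod card X)"
    then show "(q ^^ a) x = (q ^^ b) x" using m by (metis c cong_def)
  qed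
qed

lemma automorphism_comp:
  "\<phi> \<in> map_automorphisms CM \<Longrightarrow> \<psi> \<in> map_automorphisms CM \<Longrightarrow> \<phi> \<circ> \<psi> \<in> map_automorphisms CM"
  using map_iso_comp[of \<psi> CM CM \<phi> CM] permutes_compose[of \<psi> "carrier G" \<phi>] map_arcs_CM_iff
  unfolding map_automorphisms_def by force

lemma automorphism_id: "id \<in> map_automorphisms CM"
proof -
  have "map_prod id id = (id :: 'a \<times> 'a \<Rightarrow> 'a \<times> 'a)" by (simp add: fun_eq_iff)
  then show ?thesis unfolding map_automorphisms_def map_iso_def by (simp add: permutes_id)
qed

lemma automorphism_funpow:
  "\<phi> \<in> map_automorphisms CM \<Longrightarrow> \<phi> ^^ k \<in> map_automorphisms CM"
  by (induction k) (simp_all add: automorphism_id automorphism_comp)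

lemma automorphism_bij: "\<phi> \<in> map_automorphisms CM \<Longrightarrow> \<phi> permutes carrier G"
  by (simp add: map_automorphisms_def)

text \<open>A left translation moves the base vertex of an arc but keeps its label
  \<open>inv x \<otimes> y\<close>, and the rotation acts on the label alone. Outside the carrier
  the map is the identity, as \<open>map_automorphisms\<close> demands.\<close>

lemma translation_automorphism:
  assumes g: "g \<in> carrier G"
  shows "(\<lambda>h. if h \<in> carrier G then g \<otimes> h else h) \<in> map_automorphisms CM"
proof -
  let ?L = "\<lambda>h. if h \<in> carrier G then g \<otimes> h else h"
  have cancel: "inv (g \<otimes> x) \<otimes> (g \<otimes> y) = inv x \<otimes> y" if "x \<in> carrier G" "y \<in> carrier G" for x y
  proof -
    have "inv (g \<otimes> x) \<otimes> (g \<otimes> y) = inv x \<otimes> (inv g \<otimes> (g \<otimes> y))"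
      using g that by (simp add: inv_mult_group m_assoc)
    also have "inv g \<otimes> (g \<otimes> y) = y" using g that by (simp add: m_assoc[symmetric])
    finally show ?thesis .
  qed
  have bij: "bij_betw ?L (carrier G) (carrier G)"
  proof (rule bij_betwI[of _ _ _ "\<lambda>h. inv g \<otimes> h"])
    show "?L (inv g \<otimes> y) = y" if "y \<in> carrier G" for y
      using g that by (simp add: m_assoc[symmetric])
    show "inv g \<otimes> ?L y = y" if "y \<in> carrier G" for y
      using g that by (simp add: m_assoc[symmetric])
  qed (use g in auto)
  have "map_iso ?L CM CM"
    unfolding map_iso_def
  proof (intro conjI ballI)
    show "bij_betw ?L (map_verts CM) (map_verts CM)" using bij by simp
    show "(x, y) \<in> map_arcs CM \<longleftrightarrow> (?L x, ?L y) \<in> map_arcs CM"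
      if "x \<in> map_verts CM" "y \<in> map_verts CM" for x y
      using that g cancel by (simp add: map_arcs_CM_iff)
    fix a assume a: "a \<in> map_arcs CM"
    then obtain x y where xy: "a = (x, y)" "x \<in> carrier G" "y \<in> carrier G" "inv x \<otimes> y \<in> X"
      by (cases a) (auto simp: map_arcs_CM_iff)
    have "q (inv x \<otimes> y) \<in> carrier G"
      using xy(4) X_carrier q_X by blast
    then show "map_prod ?L ?L (rotation CM a) = rotation CM (map_prod ?L ?L a)"
      using xy g by (simp add: rotation_CM cancel m_assoc)
  qed
  moreover have "?L permutes carrier G"
    using bij by (rule bij_imp_permutes) auto
  ultimately show ?thesis by (simp add: map_automorphisms_def)
qed

end

text \<open>Such a \<open>\<phi>\<close> is known as a skew morphism of G; the exponent in
  \<open>phi_skew\<close> is its power function at \<open>g\<close>. \<open>phi_funpow_eq\<close>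
  allows exponents to be read modulo \<open>card X\<close>.\<close>

locale skew_cayley = cayley_data +
  fixes \<phi> :: "'a \<Rightarrow> 'a"
  assumes phi_permutes: "\<phi> permutes carrier G"
    and phi_one: "\<phi> \<one> = \<one>"
    and phi_X: "x \<in> X \<Longrightarrow> \<phi> x = q x"
    and phi_funpow_eq: "[a = b] (mod card X) \<Longrightarrow> \<phi> ^^ a = \<phi> ^^ b"
    and phi_skew: "g \<in> carrier G \<Longrightarrow> \<exists>k. \<forall>h\<in>carrier G. \<phi> (g \<otimes> h) = \<phi> g \<otimes> (\<phi> ^^ k) h"

text \<open>Existence in regularity supplies \<open>\<phi>\<close>. Uniqueness makes automorphisms
  rigid: an identity between two of them need only be tested at \<open>\<one>\<close> and at one
  \<open>x\<close> in X.\<close>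

lemma (in cayley_data) regular_map_skew:
  assumes reg: "regular_map CM"
  obtains \<phi> where "skew_cayley G X q \<phi>"
proof -
  obtain x where x: "x \<in> X"
    using q_cyclic by (auto simp: cyclic_on_def)
  have xG: "x \<in> carrier G" using x X_carrier by blast
  have arc: "(\<one>, y) \<in> map_arcs CM" if "y \<in> X" for y
    using that X_carrier by (simp add: map_arcs_CM_iff)
  have uniq: "\<alpha> = \<beta>" if ab: "\<alpha> \<in> map_automorphisms CM" "\<beta> \<in> map_automorphisms CM"
    "\<alpha> \<one> = \<beta> \<one>" "\<alpha> x = \<beta> x" for \<alpha> \<beta>
  proof -
    have "(\<alpha> \<one>, \<alpha> x) \<in> map_arcs CM"
      using ab(1) arc[OF x] xG by (simp add: map_automorphisms_def map_iso_def)
    then have "\<exists>!\<gamma>. \<gamma> \<in> map_automorphisms CM \<and> map_prod \<gamma> \<gamma> (\<one>, x) = (\<alpha> \<one>, \<alpha> x)"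
      using reg arc[OF x] unfolding regular_map_def by blast
    then show ?thesis using ab by (auto dest: ex1_implies_ex)
  qed
  obtain \<phi> where phi: "\<phi> \<in> map_automorphisms CM" "map_prod \<phi> \<phi> (\<one>, x) = (\<one>, q x)"
    using reg arc[OF x] arc[OF q_X[OF x]] unfolding regular_map_def by blast
  then have phi1: "\<phi> \<one> = \<one>" "\<phi> x = q x" by auto
  have rot: "\<phi> (q y) = q (\<phi> y)" if "y \<in> X" "\<phi> y \<in> X" for y
  proof -
    have "map_prod \<phi> \<phi> (rotation CM (\<one>, y)) = rotation CM (map_prod \<phi> \<phi> (\<one>, y))"
      using phi(1) arc[OF that(1)] by (simp add: map_automorphisms_def map_iso_def)
    then show ?thesis using that phi1 by (simp add: rotation_CM_one)
  qed
  \<comment> \<open>Compatibility with the rotation at the vertex \<open>\<one>\<close> carries the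
    agreement with \<open>q\<close> from \<open>x\<close> along the whole cycle.\<close>
  have "\<phi> ((q ^^ k) x) = q ((q ^^ k) x)" for k
    by (induction k) (use phi1 rot funpow_q_X[OF x] q_X in auto)
  then have phiX: "\<phi> y = q y" if "y \<in> X" for y
    using X_funpow_q[OF x that] by metis
  have phikX: "(\<phi> ^^ k) y = (q ^^ k) y" if "y \<in> X" for y k
    by (induction k) (use that phiX funpow_q_X[OF that] in auto)
  have phik1: "(\<phi> ^^ k) \<one> = \<one>" for k
    by (induction k) (use phi1 in auto)
  have "skew_cayley G X q \<phi>"
  proof unfold_locales
    show "\<phi> permutes carrier G" using automorphism_bij[OF phi(1)] .
    show "\<phi> \<one> = \<one>" by (rule phi1)
    show "\<phi> y = q y" if "y \<in> X" for y using phiX[OF that] .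
    show "\<phi> ^^ a = \<phi> ^^ b" if "[a = b] (mod card X)" for a b
      using that x by (intro uniq automorphism_funpow phi) (simp_all add: phik1 phikX funpow_q_eq_iff)
    fix g assume g: "g \<in> carrier G"
    let ?L = "\<lambda>g h. if h \<in> carrier G then g \<otimes> h else h"
    have pg: "\<phi> g \<in> carrier G" using g permutes_in_image[OF automorphism_bij[OF phi(1)]] by blast
    have arc_g: "(g, g \<otimes> x) \<in> map_arcs CM" using cayley_map_simps(1)[OF g x] .
    have "(\<phi> g, \<phi> (g \<otimes> x)) \<in> map_arcs CM"
      using phi(1) arc_g g xG by (simp add: map_automorphisms_def map_iso_def)
    then have "inv (\<phi> g) \<otimes> \<phi> (g \<otimes> x) \<in> X" and pgx: "\<phi> (g \<otimes> x) \<in> carrier G"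
      by (simp_all add: map_arcs_CM_iff)
    then obtain k where k: "inv (\<phi> g) \<otimes> \<phi> (g \<otimes> x) = (q ^^ k) x"
      using X_funpow_q[OF x] by blast
    have kG: "(q ^^ k) x \<in> carrier G" using funpow_q_X[OF x] X_carrier by blast
    have "\<phi> (g \<otimes> x) = \<phi> g \<otimes> (q ^^ k) x"
      unfolding k[symmetric] using pg pgx by (simp add: m_assoc[symmetric])
    \<comment> \<open>The exponent \<open>k\<close> was read off at \<open>x\<close>, so both
      automorphisms send the arc from \<open>\<one>\<close> to \<open>x\<close> to the same
      arc.\<close>
    then have "\<phi> \<circ> ?L g = ?L (\<phi> g) \<circ> \<phi> ^^ k"
      using g xG pg kG x
      by (intro uniq automorphism_comp translation_automorphism automorphism_funpow phi)
        (simp_all add: phik1 phikX)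
    note eq = fun_cong[OF this]
    have "(\<phi> ^^ k) h \<in> carrier G" if "h \<in> carrier G" for h
      using that permutes_in_image[OF automorphism_bij[OF automorphism_funpow[OF phi(1)]]] by blast
    then have "\<phi> (g \<otimes> h) = \<phi> g \<otimes> (\<phi> ^^ k) h" if "h \<in> carrier G" for h
      using eq[of h] that by simp
    then have "\<forall>h\<in>carrier G. \<phi> (g \<otimes> h) = \<phi> g \<otimes> (\<phi> ^^ k) h" by blast
    then show "\<exists>k. \<forall>h\<in>carrier G. \<phi> (g \<otimes> h) = \<phi> g \<otimes> (\<phi> ^^ k) h" ..
  qed
  then show ?thesis by (rule that)
qed

section \<open>Abelian groups of prime valency\<close>

locale prime_abelian_skew = skew_cayley + comm_group G +
  assumes prime_card: "prime (card X)"
begin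

text \<open>Integer exponents are wanted for the value -1 of t and for arithmetic modulo
  \<open>card X\<close>. Reducing to a natural exponent is consistent because \<open>\<phi>\<close>
  has period \<open>card X\<close>.\<close>

definition Phi :: "int \<Rightarrow> 'a \<Rightarrow> 'a" where
  "Phi k = \<phi> ^^ nat (k mod int (card X))"

lemma card_pos: "card X > 0"
  using prime_card prime_gt_0_nat by blast

lemma phi_carrier [simp]: "\<phi> g \<in> carrier G \<longleftrightarrow> g \<in> carrier G"
  by (rule permutes_in_image[OF phi_permutes])

lemma funpow_phi_carrier [simp]: "(\<phi> ^^ n) g \<in> carrier G \<longleftrightarrow> g \<in> carrier G"
  by (induction n) auto

lemma funpow_phi_X: "x \<in> X \<Longrightarrow> (\<phi> ^^ n) x = (q ^^ n) x"
  by (induction n) (simp_all add: phi_X funpow_q_X)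

lemma Phi_carrier [simp]: "Phi k g \<in> carrier G \<longleftrightarrow> g \<in> carrier G"
  by (simp add: Phi_def)

lemma Phi_of_nat: "Phi (int n) = \<phi> ^^ n"
  unfolding Phi_def using card_pos
  by (intro phi_funpow_eq) (simp add: nat_mod_distrib cong_def)

lemma Phi_cong: "[a = b] (mod int (card X)) \<Longrightarrow> Phi a = Phi b"
  by (simp add: Phi_def cong_def)

lemma of_nat_representative:
  obtains n where "[k = int n] (mod int (card X))"
proof
  show "[k = int (nat (k mod int (card X)))] (mod int (card X))"
    using card_pos by (simp add: cong_def)
qed

lemma Phi_add: "Phi (a + b) g = Phi a (Phi b g)"
proof -
  obtain m n where mn: "[a = int m] (mod int (card X))" "[b = int n] (mod int (card X))"
    by (metis of_nat_representative)
  then have "Phi (a + b) = Phi (int (m + n))"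
    by (intro Phi_cong) (auto intro: cong_add)
  then show ?thesis
    using Phi_cong[OF mn(1)] Phi_cong[OF mn(2)] by (simp add: Phi_of_nat funpow_add del: of_nat_add)
qed

lemma Phi_zero: "Phi 0 g = g"
  by (simp add: Phi_def)

lemma Phi_one_arg: "Phi 1 = \<phi>"
  using Phi_of_nat[of 1] by simp

text \<open>Each element of X lies on a full cycle of length \<open>card X\<close>, so a single
  point recovers the exponent.\<close>

lemma Phi_eq_on_X:
  assumes x: "x \<in> X" and eq: "Phi a x = Phi b x"
  shows "[a = b] (mod int (card X))"
proof -
  obtain m n where mn: "[a = int m] (mod int (card X))" "[b = int n] (mod int (card X))"
    by (metis of_nat_representative)
  then have "(q ^^ m) x = (q ^^ n) x"
    using eq Phi_cong[OF mn(1)] Phi_cong[OF mn(2)] by (simp add: Phi_of_nat funpow_phi_X[OF x])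
  then have "[int m = int n] (mod int (card X))"
    using funpow_q_eq_iff[OF x] cong_int_iff by blast
  then show ?thesis using mn cong_sym cong_trans by blast
qed

lemma Phi_X: "x \<in> X \<Longrightarrow> Phi k x \<in> X"
  by (simp add: Phi_def funpow_phi_X funpow_q_X)

lemma Phi_skew:
  assumes "g \<in> carrier G"
  shows "\<exists>m. \<forall>h\<in>carrier G. Phi k (g \<otimes> h) = Phi k g \<otimes> Phi m h"
proof -
  have nat: "\<exists>m. \<forall>h\<in>carrier G. (\<phi> ^^ n) (g \<otimes> h) = (\<phi> ^^ n) g \<otimes> Phi m h" for n
  proof (induction n)
    case 0
    have "\<forall>h\<in>carrier G. (\<phi> ^^ 0) (g \<otimes> h) = (\<phi> ^^ 0) g \<otimes> Phi 0 h" by (simp add: Phi_zero)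
    then show ?case ..
  next
    case (Suc n)
    then obtain m where m: "\<forall>h\<in>carrier G. (\<phi> ^^ n) (g \<otimes> h) = (\<phi> ^^ n) g \<otimes> Phi m h" ..
    have "(\<phi> ^^ n) g \<in> carrier G" using assms by simp
    from phi_skew[OF this] obtain k where
      k: "\<forall>h\<in>carrier G. \<phi> ((\<phi> ^^ n) g \<otimes> h) = \<phi> ((\<phi> ^^ n) g) \<otimes> (\<phi> ^^ k) h" ..
    have "\<forall>h\<in>carrier G. (\<phi> ^^ Suc n) (g \<otimes> h) = (\<phi> ^^ Suc n) g \<otimes> Phi (int k + m) h"
      using m k by (simp add: Phi_add Phi_of_nat)
    then show ?case ..
  qed
  show ?thesis unfolding Phi_def[of k] by (rule nat)
qed

section \<open>The exponents as permutations of the residues modulo p\<close>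

definition sig :: "'a \<Rightarrow> int \<Rightarrow> int" where
  "sig g k = (SOME m. \<forall>h\<in>carrier G. Phi k (g \<otimes> h) = Phi k g \<otimes> Phi m h)"

lemma Phi_mult:
  "g \<in> carrier G \<Longrightarrow> h \<in> carrier G \<Longrightarrow> Phi k (g \<otimes> h) = Phi k g \<otimes> Phi (sig g k) h"
  using someI_ex[OF Phi_skew[of g k]] unfolding sig_def by blast

text \<open>\<open>sig\<close> is a choice that matters only modulo \<open>card X\<close>, and one
  \<open>x\<close> in X decides it. Thus \<open>sig_mult\<close> and \<open>sig_twist\<close> arise
  by expanding an expression of the form \<open>Phi k (g \<otimes> x)\<close> in two ways.\<close>

lemma sig_eqI:
  assumes "g \<in> carrier G" "x \<in> X" "Phi k (g \<otimes> x) = Phi k g \<otimes> Phi m x"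
  shows "[sig g k = m] (mod int (card X))"
proof -
  have "Phi k g \<otimes> Phi (sig g k) x = Phi k g \<otimes> Phi m x"
    using Phi_mult[OF assms(1) X_carrier[OF assms(2)]] assms(3) by metis
  then have "Phi (sig g k) x = Phi m x"
    using assms(1) X_carrier[OF assms(2)] by simp
  then show ?thesis using Phi_eq_on_X[OF assms(2)] by blast
qed

lemma X_nonempty: "\<exists>x. x \<in> X"
  using card_pos by (metis card.empty ex_in_conv less_irrefl)

text \<open>Associativity of \<open>g \<otimes> h \<otimes> x\<close> reverses the order of
  composition; since G is abelian, the two orders agree and the exponent maps commute.\<close>

lemma sig_mult:
  assumes "g \<in> carrier G" "h \<in> carrier G"
  shows "[sig (g \<otimes> h) k = sig h (sig g k)] (mod int (card X))"
proof -
  obtain x where x: "x \<in> X" using X_nonempty by blast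
  note xG = X_carrier[OF x]
  have "Phi k (g \<otimes> h \<otimes> x) = Phi k (g \<otimes> (h \<otimes> x))"
    using assms xG by (simp add: m_assoc)
  also have "\<dots> = Phi k g \<otimes> (Phi (sig g k) h \<otimes> Phi (sig h (sig g k)) x)"
    using assms xG by (simp add: Phi_mult)
  also have "\<dots> = Phi k (g \<otimes> h) \<otimes> Phi (sig h (sig g k)) x"
    using assms xG by (simp add: Phi_mult m_assoc)
  finally show ?thesis
    using assms x by (intro sig_eqI) auto
qed

text \<open>Splitting \<open>Phi (k + j)\<close> as \<open>Phi k\<close> after \<open>Phi j\<close>
  replaces \<open>g\<close> by \<open>Phi j g\<close>.\<close>

lemma sig_twist:
  assumes g: "g \<in> carrier G"
  shows "[sig g (k + j) = sig (Phi j g) k + sig g j] (mod int (card X))"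
proof -
  obtain x where x: "x \<in> X" using X_nonempty by blast
  note xG = X_carrier[OF x]
  have "Phi (k + j) (g \<otimes> x) = Phi k (Phi j g \<otimes> Phi (sig g j) x)"
    using g xG by (simp add: Phi_add Phi_mult)
  also have "\<dots> = Phi (k + j) g \<otimes> Phi (sig (Phi j g) k + sig g j) x"
    using g xG by (simp add: Phi_add Phi_mult)
  finally show ?thesis using g x by (intro sig_eqI) auto
qed

lemma sig_cong:
  assumes "g \<in> carrier G" "[k = l] (mod int (card X))"
  shows "[sig g k = sig g l] (mod int (card X))"
proof -
  obtain x where x: "x \<in> X" using X_nonempty by blast
  show ?thesis
    using assms x Phi_cong[OF assms(2)] X_carrier[OF x] by (intro sig_eqI[OF _ x]) (simp_all add: Phi_mult)
qed

lemma sig_one: "[sig \<one> k = k] (mod int (card X))"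
proof -
  obtain x where x: "x \<in> X" using X_nonempty by blast
  have "(\<phi> ^^ n) \<one> = \<one>" for n
    by (induction n) (simp_all add: phi_one)
  then show ?thesis
    using x X_carrier[OF x] by (intro sig_eqI[OF _ x]) (simp_all add: Phi_def)
qed

lemma sig_zero:
  assumes "g \<in> carrier G"
  shows "[sig g 0 = 0] (mod int (card X))"
proof -
  obtain x where x: "x \<in> X" using X_nonempty by blast
  then show ?thesis
    using assms by (intro sig_eqI[OF _ x]) (simp_all add: Phi_zero)
qed

lemma sig_inv:
  assumes "g \<in> carrier G"
  shows "[sig (inv g) (sig g k) = k] (mod int (card X))"
  using cong_trans[OF cong_sym[OF sig_mult[of g "inv g" k]]] sig_one assms by simp

lemma sig_twisted_permutations: "twisted_permutations (sig ` carrier G) (int (card X))"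
proof
  show "prime (int (card X))" using prime_card by simp
  fix \<sigma> assume "\<sigma> \<in> sig ` carrier G"
  then obtain g where g: "g \<in> carrier G" "\<sigma> = sig g" by blast
  show "[\<sigma> k = \<sigma> l] (mod int (card X)) \<longleftrightarrow> [k = l] (mod int (card X))" for k l
  proof
    assume "[\<sigma> k = \<sigma> l] (mod int (card X))"
    then have "[sig (inv g) (sig g k) = sig (inv g) (sig g l)] (mod int (card X))"
      unfolding g(2) using g(1) by (auto intro: sig_cong[of "inv g"])
    then show "[k = l] (mod int (card X))"
      using sig_inv[OF g(1)] cong_sym cong_trans by blast
  qed (use g sig_cong in auto)
  show "[\<sigma> 0 = 0] (mod int (card X))" using g sig_zero by simp
  show "\<exists>\<sigma>'\<in>sig ` carrier G. \<forall>k. [\<sigma> (k + j) = \<sigma>' k + \<sigma> j] (mod int (card X))" for j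
    using g sig_twist by (intro bexI[of _ "sig (Phi j g)"]) auto
  fix \<tau> assume "\<tau> \<in> sig ` carrier G"
  then obtain h where h: "h \<in> carrier G" "\<tau> = sig h" by blast
  show "[\<sigma> (\<tau> k) = \<tau> (\<sigma> k)] (mod int (card X))" for k
    using sig_mult[OF g(1) h(1)] sig_mult[OF h(1) g(1)] m_comm[OF g(1) h(1)] g(2) h(2)
    by (metis cong_sym cong_trans)
  show "\<exists>\<rho>\<in>sig ` carrier G. \<forall>k. [\<rho> (\<sigma> k) = \<tau> k] (mod int (card X))"
  proof (intro bexI allI)
    fix k
    have "[sig (inv g \<otimes> h) (sig g k) = sig h (sig (inv g) (sig g k))] (mod int (card X))"
      using g h by (intro sig_mult) auto
    also have "[sig h (sig (inv g) (sig g k)) = sig h k] (mod int (card X))"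
      using g h by (intro sig_cong sig_inv) auto
    finally show "[sig (inv g \<otimes> h) (\<sigma> k) = \<tau> k] (mod int (card X))" using g h by simp
  qed (use g h in auto)
qed

text \<open>Additivity and \<open>sig_twist\<close> at k = j = 1 give two values for the exponent at
  2; comparing them isolates the exponents at 1.\<close>

lemma sig_phi:
  assumes g: "g \<in> carrier G"
  shows "[sig (\<phi> g) 1 = sig g 1] (mod int (card X))"
proof -
  interpret twisted_permutations "sig ` carrier G" "int (card X)"
    by (rule sig_twisted_permutations)
  have "[sig g (1 + 1) = sig (\<phi> g) 1 + sig g 1] (mod int (card X))"
    using sig_twist[OF g, of 1 1] by (simp add: Phi_one_arg)
  moreover have "[sig g (1 + 1) = sig g 1 + sig g 1] (mod int (card X))"
    using g by (intro additive) auto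
  ultimately have "[sig (\<phi> g) 1 + sig g 1 = sig g 1 + sig g 1] (mod int (card X))"
    using cong_sym cong_trans by blast
  then show ?thesis by (simp only: cong_add_rcancel)
qed

lemma phi_mult_const:
  "\<exists>t. \<forall>x\<in>X. \<forall>h\<in>carrier G. \<phi> (x \<otimes> h) = \<phi> x \<otimes> Phi t h"
proof -
  obtain y where y: "y \<in> X" using X_nonempty by blast
  have "[sig ((q ^^ k) y) 1 = sig y 1] (mod int (card X))" for k
  proof (induction k)
    case (Suc k)
    then show ?case
      using sig_phi[of "(q ^^ k) y"] X_carrier funpow_q_X[OF y, of k] phi_X cong_trans
      by (metis comp_apply funpow.simps(2))
  qed simp
  then have "[sig x 1 = sig y 1] (mod int (card X))" if "x \<in> X" for x
    using X_funpow_q[OF y that] by metis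
  then have "Phi (sig x 1) = Phi (sig y 1)" if "x \<in> X" for x
    using that by (intro Phi_cong)
  then have "\<phi> (x \<otimes> h) = \<phi> x \<otimes> Phi (sig y 1) h" if "x \<in> X" "h \<in> carrier G" for x h
    using Phi_mult[of x h 1] that X_carrier by (simp add: Phi_one_arg)
  then show ?thesis by blast
qed

lemma skew_exponent:
  assumes "\<forall>x\<in>X. \<forall>h\<in>carrier G. \<phi> (x \<otimes> h) = \<phi> x \<otimes> Phi t h"
  shows "x \<in> X \<Longrightarrow> inv (q x) = Phi t (inv x)" and "[t * t = 1] (mod int (card X))"
proof -
  show inv_q: "inv (q x) = Phi t (inv x)" if x: "x \<in> X" for x
  proof -
    have "\<phi> (x \<otimes> inv x) = \<phi> x \<otimes> Phi t (inv x)"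
      using assms x X_carrier[OF x] by blast
    then have "\<one> = q x \<otimes> Phi t (inv x)"
      using x X_carrier[OF x] by (simp add: phi_one phi_X)
    then show ?thesis
      using X_carrier[OF q_X[OF x]] X_carrier[OF x] by (metis Phi_carrier inv_closed inv_equality m_comm)
  qed
  obtain x where x: "x \<in> X" using X_nonempty by blast
  \<comment> \<open>The induction needs a natural exponent; a natural representative
    \<open>n\<close> of \<open>t\<close> then makes \<open>n * t\<close> stand for
    \<open>t * t\<close>.\<close>
  have nat: "inv (Phi (int n) y) = Phi (int n * t) (inv y)" if y: "y \<in> X" for n y
  proof (induction n)
    case (Suc n)
    have eq: "Phi (int (Suc n)) y = q (Phi (int n) y)"
      using phi_X[OF Phi_X[OF y, of "int n"]] by (simp only: Phi_of_nat funpow.simps comp_apply)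
    have "inv (Phi (int (Suc n)) y) = Phi t (inv (Phi (int n) y))"
      unfolding eq by (rule inv_q[OF Phi_X[OF y]])
    also have "\<dots> = Phi (int (Suc n) * t) (inv y)"
      unfolding Suc.IH Phi_add[symmetric] by (simp add: algebra_simps)
    finally show ?case .
  qed (simp add: Phi_zero)
  obtain n where n: "[t = int n] (mod int (card X))" by (rule of_nat_representative)
  have "Phi 1 x = inv (inv (q x))"
    using X_carrier[OF q_X[OF x]] by (simp add: Phi_one_arg phi_X x)
  also have "\<dots> = inv (Phi (int n) (inv x))"
    using inv_q[OF x] Phi_cong[OF n] by simp
  also have "\<dots> = Phi (int n * t) x"
    using nat[OF inv_X[OF x]] X_carrier[OF x] by simp
  finally have "[1 = int n * t] (mod int (card X))" by (rule Phi_eq_on_X[OF x])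
  moreover have "[t * t = int n * t] (mod int (card X))"
    using n by (rule cong_scalar_right)
  ultimately show "[t * t = 1] (mod int (card X))" using cong_sym cong_trans by blast
qed

section \<open>The dichotomy for t and the resulting product formulas\<close>

lemma bij_q: "bij q"
  using permutes_bij[OF q_permutes] .

lemma Phi_minus_one: "x \<in> X \<Longrightarrow> Phi (- 1) x = Hilbert_Choice.inv q x"
proof -
  assume x: "x \<in> X"
  have "q (Phi (- 1) x) = \<phi> (Phi (- 1) x)" using Phi_X[OF x] by (simp add: phi_X)
  also have "\<dots> = x" using Phi_add[of 1 "- 1" x] by (simp add: Phi_one_arg Phi_zero)
  finally show ?thesis using bij_q by (metis bij_inv_eq_iff)
qed

lemma balanced_iff: "balanced G X q \<longleftrightarrow> (\<forall>x\<in>X. inv (q x) = Phi 1 (inv x))"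
  unfolding t_balanced_def perm_zpow_def by (auto simp: Phi_one_arg phi_X inv_X)

lemma anti_balanced_iff: "anti_balanced G X q \<longleftrightarrow> (\<forall>x\<in>X. inv (q x) = Phi (- 1) (inv x))"
  unfolding t_balanced_def perm_zpow_def by (auto simp: Phi_minus_one inv_X)

lemma skew_exponent_cases:
  assumes "\<forall>x\<in>X. \<forall>h\<in>carrier G. \<phi> (x \<otimes> h) = \<phi> x \<otimes> Phi t h"
  shows "[t = 1] (mod int (card X)) \<or> [t = - 1] (mod int (card X))"
proof -
  have "int (card X) dvd (t - 1) * (t + 1)"
    using skew_exponent(2)[OF assms] by (simp add: cong_iff_dvd_diff algebra_simps)
  then have "int (card X) dvd t - 1 \<or> int (card X) dvd t + 1"
    using prime_card by (simp add: prime_dvd_mult_iff)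
  then show ?thesis by (simp add: cong_iff_dvd_diff)
qed

theorem balanced_or_anti_balanced: "balanced G X q \<or> anti_balanced G X q"
proof -
  obtain t where t: "\<forall>x\<in>X. \<forall>h\<in>carrier G. \<phi> (x \<otimes> h) = \<phi> x \<otimes> Phi t h"
    using phi_mult_const ..
  from skew_exponent_cases[OF t] show ?thesis
    using skew_exponent(1)[OF t] Phi_cong
    unfolding balanced_iff anti_balanced_iff by metis
qed

text \<open>The exponent \<open>t\<close> from \<open>phi_mult_const\<close> and the exponent 1 from
  balance both describe \<open>inv (q x)\<close> through the single point \<open>inv x\<close> of X,
  so they agree modulo \<open>card X\<close>.\<close>

lemma phi_mult_balanced:
  assumes "balanced G X q" "x \<in> X" "h \<in> carrier G"
  shows "\<phi> (x \<otimes> h) = \<phi> x \<otimes> \<phi> h"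
proof -
  obtain t where t: "\<forall>x\<in>X. \<forall>h\<in>carrier G. \<phi> (x \<otimes> h) = \<phi> x \<otimes> Phi t h"
    using phi_mult_const ..
  have "Phi t (inv x) = Phi 1 (inv x)"
    using skew_exponent(1)[OF t] assms(1,2) unfolding balanced_iff by metis
  then have "Phi t = Phi 1"
    using Phi_eq_on_X[OF inv_X[OF assms(2)]] Phi_cong by blast
  then show ?thesis using t assms(2,3) by (simp add: Phi_one_arg)
qed

lemma phi_mult_anti_balanced:
  assumes "anti_balanced G X q" "x \<in> X" "y \<in> X"
  shows "\<phi> (x \<otimes> y) = q x \<otimes> Hilbert_Choice.inv q y"
proof -
  obtain t where t: "\<forall>x\<in>X. \<forall>h\<in>carrier G. \<phi> (x \<otimes> h) = \<phi> x \<otimes> Phi t h"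
    using phi_mult_const ..
  have "Phi t (inv x) = Phi (- 1) (inv x)"
    using skew_exponent(1)[OF t] assms(1,2) unfolding anti_balanced_iff by metis
  then have "Phi t = Phi (- 1)"
    using Phi_eq_on_X[OF inv_X[OF assms(2)]] Phi_cong by blast
  then show ?thesis
    using t assms(2,3) X_carrier[OF assms(3)] by (simp add: Phi_minus_one phi_X)
qed

lemma involution_exists:
  assumes "card X \<noteq> 2"
  obtains x where "x \<in> X" "inv x = x"
proof -
  have "odd (card X)"
    using assms primes_dvd_imp_eq[OF two_is_prime_nat prime_card] by auto
  moreover have "even (card X)" if "\<And>x. x \<in> X \<Longrightarrow> inv x \<noteq> x"
  proof -
    \<comment> \<open>Without an involution, each pair \<open>x\<close>, \<open>inv x\<close>
      contributes 1 + 1 = 0 to the count of X in the two-element field.\<close>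
    have "(of_nat (card X) :: bit) = 0"
      using sum_involution_eq_0[of X "\<lambda>_. 1 :: bit" "\<lambda>x. inv x"] that inv_X X_carrier by simp
    then have "even (of_nat (card X) :: bit)" by simp
    then show ?thesis by (simp only: even_of_nat_iff)
  qed
  ultimately show thesis using that by blast
qed

end

section \<open>Transport along group isomorphisms and linear algebra over two elements\<close>

text \<open>The conjugate of \<open>q\<close> by \<open>f\<close>; it is the identity off the image
  because \<open>cayley_data\<close> asks for \<open>permutes\<close>.\<close>

definition transport_perm :: "('a \<Rightarrow> 'b) \<Rightarrow> 'a set \<Rightarrow> ('a \<Rightarrow> 'a) \<Rightarrow> 'b \<Rightarrow> 'b" where
  "transport_perm f X q = (\<lambda>y. if y \<in> f ` X then f (q (inv_into X f y)) else y)"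

context cayley_data
begin

text \<open>Only the values of \<open>r\<close> on the image of X are prescribed, so
  \<open>r\<close> can be \<open>transport_perm\<close> or a cycle given in advance such as
  \<open>odd_cycle\<close>.\<close>

lemma map_isomorphic_iso:
  assumes f: "f \<in> iso G H" and H: "group H"
    and r: "\<And>x. x \<in> X \<Longrightarrow> r (f x) = f (q x)"
  shows "map_isomorphic CM (cayley_map H (f ` X) r)"
proof -
  interpret gh: group_hom G H f
    using f H by (intro group_hom.intro group_hom_axioms.intro) (simp_all add: iso_def group_axioms)
  have bij: "bij_betw f (carrier G) (carrier H)" and inj: "inj_on f (carrier G)"
    using f by (auto simp: iso_def bij_betw_def)
  have quot: "inv\<^bsub>H\<^esub> (f x) \<otimes>\<^bsub>H\<^esub> f y = f (inv x \<otimes> y)" if "x \<in> carrier G" "y \<in> carrier G" for x y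
    using that by simp
  have mem: "f z \<in> f ` X \<longleftrightarrow> z \<in> X" if "z \<in> carrier G" for z
    using that inj X_subset by (auto dest: inj_onD)
  have "map_iso f CM (cayley_map H (f ` X) r)"
    unfolding map_iso_def
  proof (intro conjI ballI)
    show "bij_betw f (map_verts CM) (map_verts (cayley_map H (f ` X) r))"
      using bij by (simp add: cayley_map_def cayley_graph_def)
    show "(x, y) \<in> map_arcs CM \<longleftrightarrow> (f x, f y) \<in> map_arcs (cayley_map H (f ` X) r)"
      if "x \<in> map_verts CM" "y \<in> map_verts CM" for x y
      using that mem[of "inv x \<otimes> y"] quot[of x y]
      by (auto simp: cayley_map_def cayley_graph_def simp del: gh.hom_mult)
    fix a assume a: "a \<in> map_arcs CM"
    then obtain x y where xy: "a = (x, y)" "x \<in> carrier G" "y \<in> carrier G" "inv x \<otimes> y \<in> X"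
      by (cases a) (auto simp: map_arcs_CM_iff)
    have "rotation (cayley_map H (f ` X) r) (f x, f y) = (f x, f x \<otimes>\<^bsub>H\<^esub> r (f (inv x \<otimes> y)))"
      using xy quot[OF xy(2,3)] by (simp add: cayley_map_def cayley_graph_def del: gh.hom_mult)
    also have "\<dots> = (f x, f (x \<otimes> q (inv x \<otimes> y)))"
      using xy(2) r[OF xy(4)] X_carrier[OF q_X[OF xy(4)]] by (simp only: gh.hom_mult)
    finally show "map_prod f f (rotation CM a) = rotation (cayley_map H (f ` X) r) (map_prod f f a)"
      using xy by (simp add: rotation_CM)
  qed
  then show ?thesis unfolding map_isomorphic_def by blast
qed

lemma transport_perm_image:
  assumes "inj_on f (carrier G)" "x \<in> X"
  shows "transport_perm f X q (f x) = f (q x)"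
  using assms X_subset by (simp add: transport_perm_def inv_into_f_f inj_on_subset)

lemma cayley_data_transport:
  assumes f: "f \<in> iso G H" and H: "group H"
  shows "cayley_data H (f ` X) (transport_perm f X q)"
proof -
  interpret gh: group_hom G H f
    using f H by (intro group_hom.intro group_hom_axioms.intro) (simp_all add: iso_def group_axioms)
  have onto: "f ` carrier G = carrier H" and inj: "inj_on f (carrier G)"
    using f by (auto simp: iso_def bij_betw_def)
  note tr = transport_perm_image[OF inj]
  show ?thesis
  proof unfold_locales
    show "finite (carrier H)" using onto finite_carrier by (metis finite_imageI)
    show "f ` X \<subseteq> carrier H" using X_subset by auto
    have "(\<lambda>y. inv\<^bsub>H\<^esub> y) ` f ` X = f ` (\<lambda>x. inv x) ` X"
      unfolding image_image using X_carrier by (intro image_cong) auto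
    then show "(\<lambda>y. inv\<^bsub>H\<^esub> y) ` f ` X = f ` X" by (simp add: X_inv)
    show "\<one>\<^bsub>H\<^esub> \<notin> f ` X"
    proof
      assume "\<one>\<^bsub>H\<^esub> \<in> f ` X"
      then obtain x where "x \<in> X" "f x = f \<one>" by auto
      then show False using inj X_carrier one_notin_X by (metis inj_onD one_closed)
    qed
    show "generate H (f ` X) = carrier H"
      using gh.generate_img[OF X_subset] by (simp add: X_generates onto)
    show "cyclic_on (transport_perm f X q) (f ` X)"
      using q_cyclic by (rule cyclic_on_image) (rule tr)
    have injX: "inj_on f X" using inj X_subset by (rule inj_on_subset)
    show "transport_perm f X q permutes f ` X"
    proof (rule bij_imp_permutes)
      have "bij_betw (f \<circ> q \<circ> inv_into X f) (f ` X) (f ` X)"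
        using bij_betw_inv_into[OF inj_on_imp_bij_betw[OF injX]] permutes_imp_bij[OF q_permutes]
          inj_on_imp_bij_betw[OF injX] by (blast intro: bij_betw_trans)
      then show "bij_betw (transport_perm f X q) (f ` X) (f ` X)"
        by (rule iffD1[OF bij_betw_cong, rotated]) (simp add: transport_perm_def)
    qed (simp add: transport_perm_def)
  qed
qed

end

section \<open>Additive maps as matrices over two elements, and groups of exponent two\<close>

lemma bit_add_self: "(a :: bit) + a = 0"
  by (cases a) auto

lemma bit_vec_add_self: "v \<in> carrier_vec n \<Longrightarrow> v + v = (0\<^sub>v n :: bit vec)"
  by (intro eq_vecI) (auto simp: bit_add_self)

text \<open>The only scalars are 0 and 1, so additive maps are linear. The induction runs over a
  bound \<open>k\<close> beyond which all coordinates of \<open>v\<close> vanish.\<close>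

lemma additive_eq_mat:
  fixes F :: "bit vec \<Rightarrow> bit vec"
  assumes F: "\<And>v. v \<in> carrier_vec n \<Longrightarrow> F v \<in> carrier_vec n"
    and add: "\<And>u v. u \<in> carrier_vec n \<Longrightarrow> v \<in> carrier_vec n \<Longrightarrow> F (u + v) = F u + F v"
    and v: "v \<in> carrier_vec n"
  shows "mat n n (\<lambda>(i, j). F (unit_vec n j) $ i) *\<^sub>v v = F v"
proof -
  let ?A = "mat n n (\<lambda>(i, j). F (unit_vec n j) $ i)"
  have A: "?A \<in> carrier_mat n n" by simp
  have unit: "?A *\<^sub>v unit_vec n k = F (unit_vec n k)" if "k < n" for k
    using that F[OF unit_vec_carrier, of k]
    by (intro eq_vecI) (auto simp: scalar_prod_right_unit)
  have zero: "F (0\<^sub>v n) = 0\<^sub>v n"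
  proof -
    have "F (0\<^sub>v n) = F (0\<^sub>v n) + F (0\<^sub>v n)" using add[of "0\<^sub>v n" "0\<^sub>v n"] by simp
    also have "\<dots> = 0\<^sub>v n" using F by (intro bit_vec_add_self) simp
    finally show ?thesis .
  qed
  have "?A *\<^sub>v v = F v" if "v \<in> carrier_vec n" "k \<le> n" "\<And>i. k \<le> i \<Longrightarrow> i < n \<Longrightarrow> v $ i = 0" for v k
    using that
  proof (induction k arbitrary: v)
    case 0
    then have "v = 0\<^sub>v n" by (intro eq_vecI) auto
    have "?A *\<^sub>v 0\<^sub>v n = 0\<^sub>v n" by (intro eq_vecI) auto
    then show ?case using \<open>v = 0\<^sub>v n\<close> zero by simp
  next
    case (Suc k)
    show ?case
    proof (cases "v $ k = 0")
      case True
      show ?thesis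
      proof (rule Suc.IH)
        show "v $ i = 0" if "k \<le> i" "i < n" for i
          using Suc.prems(3)[of i] True that by (cases "i = k") auto
      qed (use Suc.prems in auto)
    next
      case False
      \<comment> \<open>Adding the unit vector clears coordinate \<open>k\<close>; adding it again
        restores \<open>v\<close>.\<close>
      define w where "w = v + unit_vec n k"
      have w: "w \<in> carrier_vec n" using Suc.prems by (simp add: w_def)
      have vk: "v $ k = 1" using False by (cases "v $ k") auto
      have "w $ i = 0" if "k \<le> i" "i < n" for i
        using Suc.prems(1) Suc.prems(3)[of i] vk that by (cases "i = k") (auto simp: w_def)
      then have IH: "?A *\<^sub>v w = F w" using Suc.IH[OF w] Suc.prems by simp
      have "w + unit_vec n k = v + (unit_vec n k + unit_vec n k)"
        using Suc.prems by (simp add: w_def assoc_add_vec[of _ n])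
      then have v: "v = w + unit_vec n k"
        using Suc.prems by (simp add: bit_vec_add_self[of _ n])
      have "?A *\<^sub>v (w + unit_vec n k) = ?A *\<^sub>v w + ?A *\<^sub>v unit_vec n k"
        using w by (intro mult_add_distrib_mat_vec[OF A]) auto
      also have "\<dots> = F (w + unit_vec n k)"
        using IH unit Suc.prems(2) w by (simp add: add)
      finally show ?thesis using v by simp
    qed
  qed
  from this[OF v, of n] show ?thesis by simp
qed

lemma mat_eq_of_mult_vec:
  fixes A B :: "'b :: semiring_1 mat"
  assumes A: "A \<in> carrier_mat n n" and B: "B \<in> carrier_mat n n"
    and eq: "\<And>v. v \<in> carrier_vec n \<Longrightarrow> A *\<^sub>v v = B *\<^sub>v v"
  shows "A = B"
proof (rule eq_matI)
  fix i j assume "i < dim_row B" "j < dim_col B"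
  then have ij: "i < n" "j < n" using B by auto
  have "(A *\<^sub>v unit_vec n j) $ i = (B *\<^sub>v unit_vec n j) $ i" using eq by simp
  then show "A $$ (i, j) = B $$ (i, j)"
    using A B ij by (simp add: scalar_prod_right_unit)
qed (use A B in auto)

lemma pow_mat_mult_vec:
  fixes A :: "'b :: comm_semiring_1 mat"
  assumes A: "A \<in> carrier_mat n n" and v: "v \<in> carrier_vec n"
  shows "(A ^\<^sub>m k) *\<^sub>v v = ((\<lambda>v. A *\<^sub>v v) ^^ k) v"
  using v
proof (induction k arbitrary: v)
  case (Suc k)
  have "(A ^\<^sub>m Suc k) *\<^sub>v v = (A ^\<^sub>m k) *\<^sub>v (A *\<^sub>v v)"
    using A Suc.prems by (simp add: assoc_mult_mat_vec[of _ n n _ n])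
  then show ?case
    using Suc.IH[of "A *\<^sub>v v"] A Suc.prems by (simp add: funpow_swap1)
qed (use A in simp)

text \<open>An embedding of the largest possible \<open>Z2_pow n\<close> is onto: an element outside
  its image would serve as one more basis vector.\<close>

lemma (in comm_group) exponent_two_iso_Z2_pow:
  assumes fin: "finite (carrier G)" and sq: "\<And>g. g \<in> carrier G \<Longrightarrow> g \<otimes> g = \<one>"
  obtains n f where "f \<in> iso (Z2_pow n) G"
proof -
  let ?P = "\<lambda>n. \<exists>f \<in> hom (Z2_pow n) G. inj_on f (carrier (Z2_pow n))"
  have "(\<lambda>_. \<one>) \<in> hom (Z2_pow 0) G" "inj_on (\<lambda>_. \<one>) (carrier (Z2_pow 0))"
    by (auto simp: hom_def inj_on_def monoid_vec_simps intro: eq_vecI)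
  then have P0: "?P 0" by blast
  \<comment> \<open>A crude bound suffices for a maximum to exist: the unit vectors have distinct
    images.\<close>
  have bound: "n \<le> card (carrier G)" if P: "?P n" for n
  proof -
    obtain f where f: "f \<in> hom (Z2_pow n) G" "inj_on f (carrier (Z2_pow n))" using P by blast
    have "inj_on (\<lambda>i. f (unit_vec n i)) {..<n}"
    proof (rule inj_onI)
      fix i j assume "i \<in> {..<n}" "j \<in> {..<n}" "f (unit_vec n i) = f (unit_vec n j)"
      moreover from this have "unit_vec n i = (unit_vec n j :: bit vec)"
        using f(2) by (auto simp: inj_on_def monoid_vec_simps)
      ultimately show "i = j" by simp
    qed
    moreover have "(\<lambda>i. f (unit_vec n i)) ` {..<n} \<subseteq> carrier G"
      using f(1) by (auto simp: hom_def monoid_vec_simps)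
    ultimately show ?thesis using card_inj_on_le[OF _ _ fin] by fastforce
  qed
  obtain n where n: "?P n" "\<And>m. ?P m \<Longrightarrow> m \<le> n"
    using GreatestI_nat[of ?P 0 "card (carrier G)"] Greatest_le_nat[of ?P _ "card (carrier G)"] P0 bound
    by blast
  then obtain f where f: "f \<in> hom (Z2_pow n) G" "inj_on f (carrier_vec n)"
    by (auto simp: monoid_vec_simps)
  have fc: "f v \<in> carrier G" if "v \<in> carrier_vec n" for v
    using f(1) that by (auto simp: hom_def monoid_vec_simps)
  have fadd: "f (u + v) = f u \<otimes> f v" if "u \<in> carrier_vec n" "v \<in> carrier_vec n" for u v
    using f(1) that by (simp add: hom_def monoid_vec_simps)
  have "g \<in> f ` carrier_vec n" if g: "g \<in> carrier G" for g
  proof (rule ccontr)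
    assume ng: "g \<notin> f ` carrier_vec n"
    define e where "e b = (if b = (1 :: bit) then g else \<one>)" for b
    define res where "res v = vec n (\<lambda>i. v $ i)" for v :: "bit vec"
    define f' where "f' v = f (res v) \<otimes> e (v $ n)" for v
    have res: "res v \<in> carrier_vec n" for v by (simp add: res_def)
    have ec: "e b \<in> carrier G" for b using g by (simp add: e_def)
    have e_add: "e (a + b) = e a \<otimes> e b" for a b
      using g sq by (cases a; cases b) (auto simp: e_def)
    have res_add: "res (u + v) = res u + res v" if "v \<in> carrier_vec (Suc n)" for u v
      using that by (intro eq_vecI) (auto simp: res_def)
    have "f' \<in> hom (Z2_pow (Suc n)) G"
    proof (rule homI)
      fix u v assume "u \<in> carrier (Z2_pow (Suc n))" "v \<in> carrier (Z2_pow (Suc n))"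
      then have uv: "u \<in> carrier_vec (Suc n)" "v \<in> carrier_vec (Suc n)" by (simp_all add: monoid_vec_simps)
      have "f' (u + v) = (f (res u) \<otimes> f (res v)) \<otimes> (e (u $ n) \<otimes> e (v $ n))"
      proof -
        have "(u + v) $ n = u $ n + v $ n" using uv by simp
        then show ?thesis by (simp only: f'_def res_add[OF uv(2)] fadd[OF res res] e_add)
      qed
      also have "\<dots> = f' u \<otimes> f' v"
        using fc res ec by (simp add: f'_def m_ac)
      finally show "f' (u \<otimes>\<^bsub>Z2_pow (Suc n)\<^esub> v) = f' u \<otimes> f' v" by (simp add: monoid_vec_simps)
    qed (simp add: f'_def fc res ec)
    moreover have "inj_on f' (carrier (Z2_pow (Suc n)))"
    proof (rule inj_onI)
      fix u v assume "u \<in> carrier (Z2_pow (Suc n))" "v \<in> carrier (Z2_pow (Suc n))" and eq: "f' u = f' v"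
      then have uv: "u \<in> carrier_vec (Suc n)" "v \<in> carrier_vec (Suc n)" by (simp_all add: monoid_vec_simps)
      \<comment> \<open>Equal values put \<open>e (u $ n + v $ n)\<close> into the image of
        \<open>f\<close>. Since \<open>g\<close> is not there, the last coordinates must
        agree.\<close>
      have "f (res u) \<otimes> f (res v) = e (u $ n) \<otimes> e (v $ n)"
      proof -
        have "f (res u) \<otimes> f (res v) \<otimes> (e (v $ n) \<otimes> e (u $ n)) = f' u \<otimes> f' v \<otimes> (\<one> \<otimes> \<one>)"
          unfolding f'_def using fc res ec by (simp add: m_ac)
        also have "\<dots> = \<one>" using eq fc res ec sq by (simp add: f'_def)
        finally have "f (res u) \<otimes> f (res v) = inv (e (v $ n) \<otimes> e (u $ n))"
          using fc res ec by (intro inv_equality[symmetric]) auto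
        also have "\<dots> = e (v $ n) \<otimes> e (u $ n)"
          using ec sq by (intro inv_equality) auto
        finally show ?thesis using ec by (simp add: m_comm)
      qed
      then have sum: "f (res u + res v) = e (u $ n + v $ n)"
        by (simp only: fadd[OF res res] e_add)
      then have "u $ n + v $ n \<noteq> 1"
        using ng res by (metis add_carrier_vec e_def image_eqI)
      then have last: "u $ n = v $ n" by (cases "u $ n"; cases "v $ n") auto
      then have "f (res u) = f (res v)" using eq fc res ec by (simp add: f'_def)
      then have "res u = res v" using f(2) res by (auto dest: inj_onD)
      then have init: "u $ i = v $ i" if "i < n" for i
        using that by (metis index_vec res_def)
      show "u = v"
        using uv init last by (intro eq_vecI) (auto simp: less_Suc_eq)
    qed
    ultimately have "Suc n \<le> n" using n(2) by blast
    then show False by simp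
  qed
  then have "f ` carrier_vec n = carrier G" using fc by blast
  then have "f \<in> iso (Z2_pow n) G"
    using f by (simp add: iso_def bij_betw_def monoid_vec_simps)
  then show thesis by (rule that)
qed

section \<open>The two classes\<close>

context prime_abelian_skew
begin

section \<open>The balanced case\<close>

lemma X_funpow_q_less:
  assumes "x \<in> X"
  shows "X = {(q ^^ i) x | i. i \<le> card X - 1}"
proof (intro equalityI subsetI)
  fix y assume "y \<in> X"
  then obtain k where "y = (q ^^ k) x" using X_funpow_q[OF assms] by blast
  also have "\<dots> = (q ^^ (k mod card X)) x"
    using funpow_q_eq_iff[OF assms] by (simp add: cong_def)
  finally show "y \<in> {(q ^^ i) x | i. i \<le> card X - 1}"
    using mod_less_divisor[OF card_pos, of k] by fastforce
qed (use assms funpow_q_X in auto)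

lemma balanced_phi_hom:
  assumes bal: "balanced G X q" and g: "g \<in> carrier G" and h: "h \<in> carrier G"
  shows "\<phi> (g \<otimes> h) = \<phi> g \<otimes> \<phi> h"
proof -
  have "g \<in> generate G X" using g by (simp add: X_generates)
  then have "\<forall>h\<in>carrier G. \<phi> (g \<otimes> h) = \<phi> g \<otimes> \<phi> h"
  proof (induction rule: generate.induct)
    case one
    then show ?case by (simp add: phi_one)
  next
    case (incl x)
    then show ?case using phi_mult_balanced[OF bal] by blast
  next
    case (inv x)
    then show ?case using phi_mult_balanced[OF bal] inv_X by blast
  next
    case (eng g1 g2)
    then have "g1 \<in> carrier G" "g2 \<in> carrier G" by (simp_all add: X_generates)
    then show ?case using eng.IH by (simp add: m_assoc)
  qed
  then show ?thesis using h by blast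
qed

lemma balanced_exponent_two:
  assumes bal: "balanced G X q" and odd: "card X \<noteq> 2" and g: "g \<in> carrier G"
  shows "g \<otimes> g = \<one>"
proof -
  obtain x0 where x0: "x0 \<in> X" "inv x0 = x0" using involution_exists[OF odd] by blast
  \<comment> \<open>Balance means that \<open>q\<close> commutes with inversion on X, so the one
    involution \<open>x0\<close> spreads over the whole cycle.\<close>
  have step: "inv (q x) = q (inv x)" if "x \<in> X" for x
    using bal that unfolding t_balanced_def perm_zpow_def by simp
  have "inv ((q ^^ k) x0) = (q ^^ k) x0" for k
    by (induction k) (simp_all add: x0 step funpow_q_X)
  then have invX: "inv x = x" if "x \<in> X" for x
    using X_funpow_q[OF x0(1) that] by metis
  then have X2: "x \<otimes> x = \<one>" if "x \<in> X" for x
    using that X_carrier[OF that] by (metis r_inv)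
  have "g \<in> generate G X" using g by (simp add: X_generates)
  then show ?thesis
  proof (induction rule: generate.induct)
    case (eng g1 g2)
    then have c: "g1 \<in> carrier G" "g2 \<in> carrier G" by (simp_all add: X_generates)
    have "g1 \<otimes> g2 \<otimes> (g1 \<otimes> g2) = (g1 \<otimes> g1) \<otimes> (g2 \<otimes> g2)"
      using c by (simp add: m_ac)
    then show ?case using eng.IH by simp
  qed (use X2 inv_X in auto)
qed

theorem balanced_classification:
  assumes bal: "balanced G X q" and odd: "card X \<noteq> 2"
  shows "\<exists>n X1 q1.
         cayley_data (Z2_pow n) X1 q1 \<and>
         map_isomorphic (cayley_map G X q) (cayley_map (Z2_pow n) X1 q1) \<and>
         (\<exists>A\<in>GL2 n. \<exists>x\<in>carrier_vec n.
            X1 = {(A ^\<^sub>m i) *\<^sub>v x | i. i \<le> card X - 1} \<and>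
            A ^\<^sub>m card X = 1\<^sub>m n \<and> (\<forall>k. 0 < k \<and> k < card X \<longrightarrow> A ^\<^sub>m k \<noteq> 1\<^sub>m n) \<and>
            generate (Z2_pow n) {(A ^\<^sub>m i) *\<^sub>v x | i. i \<le> card X - 1} = carrier (Z2_pow n) \<and>
            (\<forall>i \<le> card X - 1. q1 ((A ^\<^sub>m i) *\<^sub>v x) = (A ^\<^sub>m (i + 1)) *\<^sub>v x))"
proof -
  obtain n f where f: "f \<in> iso (Z2_pow n) G"
    using exponent_two_iso_Z2_pow[OF finite_carrier balanced_exponent_two[OF bal odd]] by blast
  interpret Z: comm_group "Z2_pow n" by (rule comm_group_vec)
  define g where "g = inv_into (carrier_vec n) f"
  have g: "g \<in> iso G (Z2_pow n)"
    using Z.iso_set_sym[OF f] by (simp add: g_def monoid_vec_simps)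
  have fbij: "bij_betw f (carrier_vec n) (carrier G)"
    using f by (simp add: iso_def monoid_vec_simps)
  have gc: "g h \<in> carrier_vec n" if "h \<in> carrier G" for h
    using that bij_betwE[OF bij_betw_inv_into[OF fbij]] by (simp add: g_def)
  have fc: "f v \<in> carrier G" if "v \<in> carrier_vec n" for v
    using that bij_betwE[OF fbij] by blast
  have fg: "f (g h) = h" if "h \<in> carrier G" for h
    using that bij_betw_inv_into_right[OF fbij] by (simp add: g_def)
  have gf: "g (f v) = v" if "v \<in> carrier_vec n" for v
    using that bij_betw_inv_into_left[OF fbij] by (simp add: g_def)
  have injg: "inj_on g (carrier G)"
    using g by (simp add: iso_def bij_betw_def)
  \<comment> \<open>This is \<open>\<phi>\<close> in coordinates; \<open>balanced_phi_hom\<close>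
    makes it additive, hence a matrix.\<close>
  define F where "F v = g (\<phi> (f v))" for v
  define A where "A = mat n n (\<lambda>(i, j). F (unit_vec n j) $ i)"
  have A: "A \<in> carrier_mat n n" by (simp add: A_def)
  have AF: "A *\<^sub>v v = F v" if "v \<in> carrier_vec n" for v
    unfolding A_def
  proof (rule additive_eq_mat[OF _ _ that])
    show "F v \<in> carrier_vec n" if "v \<in> carrier_vec n" for v
      using that by (simp add: F_def gc fc)
    fix u v :: "bit vec" assume uv: "u \<in> carrier_vec n" "v \<in> carrier_vec n"
    have "f (u + v) = f u \<otimes> f v"
      using f uv by (simp add: iso_def hom_def monoid_vec_simps)
    moreover have "g (a \<otimes> b) = g a + g b" if "a \<in> carrier G" "b \<in> carrier G" for a b
      using g that by (simp add: iso_def hom_def monoid_vec_simps)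
    ultimately show "F (u + v) = F u + F v"
      using uv fc by (simp add: F_def balanced_phi_hom[OF bal])
  qed
  have pow: "(A ^\<^sub>m k) *\<^sub>v v = g ((\<phi> ^^ k) (f v))" if "v \<in> carrier_vec n" for k v
  proof -
    have "((\<lambda>v. A *\<^sub>v v) ^^ k) v = g ((\<phi> ^^ k) (f v))"
      by (induction k) (use that fc gc fg gf AF in \<open>simp_all add: F_def\<close>)
    then show ?thesis using pow_mat_mult_vec[OF A that] by simp
  qed
  have phi_p: "\<phi> ^^ card X = id"
    using phi_funpow_eq[of "card X" 0] by (simp add: cong_def)
  have Ap: "A ^\<^sub>m card X = 1\<^sub>m n"
  proof (rule mat_eq_of_mult_vec)
    show "(A ^\<^sub>m card X) *\<^sub>v v = 1\<^sub>m n *\<^sub>v v" if "v \<in> carrier_vec n" for v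
      using that by (simp add: pow phi_p gf)
  qed (use A in auto)
  have card_Suc: "card X = Suc (card X - 1)" using card_pos by simp
  \<comment> \<open>\<open>GL2\<close> asks for inverses on both sides, and matrix powers grow by
    right multiplication, so only the other product is a power by definition.\<close>
  have "A * A ^\<^sub>m (card X - 1) = 1\<^sub>m n"
  proof (rule mat_eq_of_mult_vec)
    show "(A * A ^\<^sub>m (card X - 1)) *\<^sub>v v = 1\<^sub>m n *\<^sub>v v" if v: "v \<in> carrier_vec n" for v
    proof -
      have "(A * A ^\<^sub>m (card X - 1)) *\<^sub>v v = A *\<^sub>v ((A ^\<^sub>m (card X - 1)) *\<^sub>v v)"
        using A v by (simp add: assoc_mult_mat_vec[of _ n n _ n])
      also have "\<dots> = g ((\<phi> ^^ Suc (card X - 1)) (f v))"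
        using v fc gc by (simp add: pow AF F_def fg)
      also have "\<dots> = v" using v phi_p card_Suc by (simp add: gf del: funpow.simps)
      finally show ?thesis using v by simp
    qed
  qed (use A in auto)
  moreover have "A ^\<^sub>m (card X - 1) * A = 1\<^sub>m n"
    using Ap card_Suc by (metis pow_mat.simps(2))
  ultimately have inv: "A \<in> GL2 n"
    using A unfolding GL2_def invertible_mat_def inverts_mat_def
    by (auto intro!: exI[of _ "A ^\<^sub>m (card X - 1)"])
  obtain x0 where x0: "x0 \<in> X" using X_nonempty by blast
  define x where "x = g x0"
  have x: "x \<in> carrier_vec n" using gc X_carrier[OF x0] by (simp add: x_def)
  have Ax: "(A ^\<^sub>m k) *\<^sub>v x = g ((q ^^ k) x0)" for k
    using pow[OF x] X_carrier[OF x0] by (simp add: x_def fg funpow_phi_X[OF x0])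
  have X1: "g ` X = {(A ^\<^sub>m i) *\<^sub>v x | i. i \<le> card X - 1}"
    unfolding Ax by (subst X_funpow_q_less[OF x0]) auto
  define q1 where "q1 = transport_perm g X q"
  have data: "cayley_data (Z2_pow n) (g ` X) q1"
    unfolding q1_def by (rule cayley_data_transport[OF g Z.group_axioms])
  have q1: "q1 (g y) = g (q y)" if "y \<in> X" for y
    unfolding q1_def by (rule transport_perm_image[OF injg that])
  \<comment> \<open>The vector \<open>x\<close> alone witnesses this: fewer than
    \<open>card X\<close> steps of \<open>q\<close> do not return to \<open>x0\<close>.\<close>
  have ord: "A ^\<^sub>m k \<noteq> 1\<^sub>m n" if "0 < k" "k < card X" for k
  proof
    assume "A ^\<^sub>m k = 1\<^sub>m n"
    then have "g ((q ^^ k) x0) = g x0" using Ax[of k] x by (simp add: x_def)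
    then have "(q ^^ k) x0 = (q ^^ 0) x0"
      using injg X_carrier[OF x0] X_carrier[OF funpow_q_X[OF x0]] by (auto dest: inj_onD)
    then show False
      using that funpow_q_eq_iff[OF x0, of k 0] by (simp add: cong_def)
  qed
  have "q1 ((A ^\<^sub>m i) *\<^sub>v x) = (A ^\<^sub>m (i + 1)) *\<^sub>v x" for i
    using q1[OF funpow_q_X[OF x0, of i]] unfolding Ax by simp
  moreover have "map_isomorphic CM (cayley_map (Z2_pow n) (g ` X) q1)"
    using g Z.group_axioms q1 by (rule map_isomorphic_iso)
  moreover have "generate (Z2_pow n) {(A ^\<^sub>m i) *\<^sub>v x | i. i \<le> card X - 1} = carrier (Z2_pow n)"
    using cayley_data.X_generates[OF data] unfolding X1 .
  ultimately show ?thesis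
    using data inv x X1 Ap ord by blast
qed

section \<open>The anti-balanced case\<close>

lemma anti_balanced_translation:
  assumes anti: "anti_balanced G X q" and odd: "card X \<noteq> 2"
  obtains d where "d \<in> carrier G" "\<And>x. x \<in> X \<Longrightarrow> q x = d \<otimes> x"
proof -
  obtain x0 where x0: "x0 \<in> X" using X_nonempty by blast
  let ?q' = "Hilbert_Choice.inv q"
  have q'q: "?q' (q x) = x" for x using bij_q by (simp add: bij_is_inj)
  have q'X: "?q' x \<in> X" if "x \<in> X" for x
    using permutes_in_image[OF permutes_inv[OF q_permutes]] that by blast
  \<comment> \<open>By commutativity \<open>\<phi>\<close> of the product of \<open>x\<close> and
    \<open>x0\<close> is both \<open>q x \<otimes> ?q' x0\<close> and
    \<open>q x0 \<otimes> ?q' x\<close>. Hence \<open>q x \<otimes> inv (?q' x)\<close> is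
    independent of \<open>x\<close>, and \<open>c\<close> is its value at \<open>x0\<close>.\<close>
  define c where "c = q x0 \<otimes> inv (?q' x0)"
  have c: "c \<in> carrier G" using X_carrier x0 q_X q'X by (simp add: c_def)
  have step: "q x = c \<otimes> ?q' x" if x: "x \<in> X" for x
  proof -
    have G: "q x \<in> carrier G" "?q' x0 \<in> carrier G" "q x0 \<in> carrier G" "?q' x \<in> carrier G"
      using x x0 q_X q'X X_carrier by auto
    have "q x \<otimes> ?q' x0 = q x0 \<otimes> ?q' x"
      using phi_mult_anti_balanced[OF anti x x0] phi_mult_anti_balanced[OF anti x0 x]
        m_comm[OF X_carrier[OF x] X_carrier[OF x0]] by simp
    then have "q x \<otimes> ?q' x0 \<otimes> inv (?q' x0) = q x0 \<otimes> ?q' x \<otimes> inv (?q' x0)" by simp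
    then show ?thesis using G by (simp add: c_def m_assoc) (simp add: m_ac)
  qed
  have qq: "q (q x) = c \<otimes> x" if "x \<in> X" for x
    using step[OF q_X[OF that]] by (simp add: q'q)
  have even: "(q ^^ (2 * k)) x = c [^] k \<otimes> x" if x: "x \<in> X" for k x
  proof (induction k)
    case (Suc k)
    have "(q ^^ (2 * Suc k)) x = c \<otimes> (q ^^ (2 * k)) x"
      using qq[OF funpow_q_X[OF x, of "2 * k"]] by simp
    then show ?case using Suc.IH c X_carrier[OF x] by (simp add: m_ac)
  qed (use X_carrier[OF x] in simp)
  \<comment> \<open>An inverse of 2 modulo the odd number \<open>card X\<close>: as \<open>q\<close>
    applied twice multiplies by \<open>c\<close>, a single \<open>q\<close> multiplies by the
    \<open>m\<close>-th power of \<open>c\<close>.\<close>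
  define m where "m = (card X + 1) div 2"
  have "odd (card X)"
    using odd primes_dvd_imp_eq[OF two_is_prime_nat prime_card] by auto
  then have m: "2 * m = card X + 1" by (simp add: m_def)
  have "q x = c [^] m \<otimes> x" if x: "x \<in> X" for x
  proof -
    have "[2 * m = 1] (mod card X)" unfolding m cong_def by (rule mod_add_self1)
    then have "(q ^^ (2 * m)) x = (q ^^ 1) x" using funpow_q_eq_iff[OF x] by blast
    then show ?thesis using even[OF x, of m] by simp
  qed
  with c show thesis using that[of "c [^] m"] by blast
qed

theorem anti_balanced_classification:
  assumes anti: "anti_balanced G X q" and odd: "card X \<noteq> 2"
  shows "map_isomorphic (cayley_map G X q)
    (cayley_map (integer_mod_group (2 * card X)) (odd_residues (card X)) (odd_cycle (card X)))"
proof -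
  let ?p = "card X"
  let ?Z = "integer_mod_group (2 * ?p)"
  interpret Z: cayley_data ?Z "odd_residues ?p" "odd_cycle ?p"
    using card_pos by (rule cayley_data_odd)
  obtain d where d: "d \<in> carrier G" and qd: "\<And>x. x \<in> X \<Longrightarrow> q x = d \<otimes> x"
    using anti_balanced_translation[OF anti odd] by blast
  obtain x0 where x0: "x0 \<in> X" "inv x0 = x0" using involution_exists[OF odd] by blast
  note x0G = X_carrier[OF x0(1)]
  have qk: "(q ^^ k) x = d [^] k \<otimes> x" if x: "x \<in> X" for x k
  proof (induction k)
    case (Suc k)
    have "(q ^^ Suc k) x = d \<otimes> (q ^^ k) x" using qd[OF funpow_q_X[OF x]] by simp
    then show ?case using Suc.IH d X_carrier[OF x] by (simp add: m_ac)
  qed (use X_carrier[OF x] in simp)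
  have dp: "d [^] ?p = \<one>"
  proof -
    have "(q ^^ ?p) x0 = (q ^^ 0) x0"
      using funpow_q_eq_iff[OF x0(1), of ?p 0] by (simp add: cong_def)
    then have "d [^] ?p \<otimes> x0 = x0" using qk[OF x0(1), of ?p] by simp
    then show ?thesis using d x0G by simp
  qed
  have d1: "d \<noteq> \<one>"
  proof
    assume "d = \<one>"
    then have "(q ^^ 1) x0 = (q ^^ 0) x0" using qd[OF x0(1)] x0G by simp
    then have "[1 = 0] (mod ?p)" using funpow_q_eq_iff[OF x0(1)] by blast
    then show False using prime_gt_1_nat[OF prime_card] by (simp add: cong_def)
  qed
  have oddp: "odd ?p"
    using odd primes_dvd_imp_eq[OF two_is_prime_nat prime_card] by auto
  define m where "m = (?p + 1) div 2"
  have m: "2 * m = ?p + 1" using oddp by (simp add: m_def)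
  \<comment> \<open>On X the power q^m multiplies by d^m, so w = d^m x0; as x0 is an involution, w
    squares to d^(2 m) = d.\<close>
  define w where "w = (q ^^ m) x0"
  have w: "w \<in> X" unfolding w_def by (rule funpow_q_X[OF x0(1)])
  note wG [simp] = X_carrier[OF w]
  have w2: "w \<otimes> w = d"
  proof -
    have "w \<otimes> w = d [^] m \<otimes> d [^] m \<otimes> (x0 \<otimes> x0)"
      using qk[OF x0(1), of m] d x0G by (simp add: w_def m_ac)
    also have "x0 \<otimes> x0 = \<one>" using x0 x0G by (metis r_inv)
    also have "d [^] m \<otimes> d [^] m = d [^] (2 * m)" using d by (simp add: nat_pow_mult mult_2)
    also have "\<dots> = d" using d dp by (simp add: m)
    finally show ?thesis using d by simp
  qed
  \<comment> \<open>The odd powers of \<open>w\<close> run through X in the order of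
    \<open>q\<close>, just as \<open>odd_cycle\<close> runs through the odd residues.\<close>
  have wk: "w [^] (2 * k + 1) = (q ^^ k) w" for k :: nat
  proof -
    have "w [^] (2 * k + 1) = (w [^] (2::nat)) [^] k \<otimes> w" by (simp add: nat_pow_pow)
    also have "w [^] (2::nat) = d" using w2 by (simp add: numeral_2_eq_2)
    finally show ?thesis using qk[OF w] by simp
  qed
  have ord: "ord w = 2 * ?p"
  proof -
    have "w [^] (2 * ?p) = (w [^] (2::nat)) [^] ?p" by (simp add: nat_pow_pow)
    also have "\<dots> = \<one>" using w2 dp by (simp add: numeral_2_eq_2)
    finally have dvd: "ord w dvd 2 * ?p" using pow_eq_id[OF wG] by blast
    obtain k where k: "?p = 2 * k + 1" using oddp by (auto elim: oddE)
    \<comment> \<open>An odd power of \<open>w\<close> lies in X and so is not the identity.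
      Together with w^2 = d, which is not the identity either, this excludes the proper divisors of
      2 p as the order.\<close>
    have "w [^] ?p \<in> X" unfolding k wk by (rule funpow_q_X[OF w])
    then have np: "\<not> ord w dvd ?p" using one_notin_X pow_eq_id[OF wG] by metis
    have "w [^] (2::nat) \<noteq> \<one>" using w2 d1 by (simp add: numeral_2_eq_2)
    then have n2: "\<not> ord w dvd 2" using pow_eq_id[OF wG] by blast
    have "?p dvd ord w"
    proof (rule ccontr)
      assume "\<not> ?p dvd ord w"
      then have "coprime (ord w) ?p"
        using prime_imp_coprime[OF prime_card] coprime_commute by blast
      then show False using dvd n2 coprime_dvd_mult_left_iff by blast
    qed
    then obtain e where e: "ord w = ?p * e" by (rule dvdE)
    then have "e dvd 2" using dvd card_pos by (simp add: mult.commute)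
    then have "e = 1 \<or> e = 2" using primes_dvd_imp_eq two_is_prime_nat prime_nat_iff by metis
    then show ?thesis using e np by auto
  qed
  define h where "h k = w [^] k" for k :: int
  have carZ: "carrier ?Z = {0..<2 * int ?p}"
    using card_pos by (simp add: carrier_integer_mod_group)
  have h_eq: "h a = h b \<longleftrightarrow> [a = b] (mod 2 * int ?p)" for a b
    using int_pow_eq[OF wG, of a b] by (simp add: h_def ord cong_iff_dvd_diff dvd_diff_commute)
  have h_nat: "h (int k) = w [^] k" for k by (simp add: h_def int_pow_int)
  have h_odd: "h (2 * int k + 1) = (q ^^ k) w" for k
    using h_nat[of "2 * k + 1"] unfolding wk by (simp add: add.commute)
  have h_mult: "h (a + b) = h a \<otimes> h b" for a b by (simp add: h_def int_pow_mult)
  have "h \<in> hom ?Z G"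
  proof (rule homI)
    show "h (a \<otimes>\<^bsub>?Z\<^esub> b) = h a \<otimes> h b" for a b
      using h_eq[of "(a + b) mod (2 * int ?p)" "a + b"] by (simp add: h_mult cong_def)
  qed (simp add: h_def)
  moreover have "inj_on h (carrier ?Z)"
    unfolding carZ by (auto simp: inj_on_def h_eq cong_def)
  moreover have "h ` carrier ?Z = carrier G"
  proof (intro equalityI subsetI)
    fix g assume "g \<in> carrier G"
    then have "g \<in> generate G X" by (simp add: X_generates)
    then have "\<exists>k. g = h k"
    proof (induction rule: generate.induct)
      case one
      then show ?case by (intro exI[of _ 0]) (simp add: h_def)
    next
      case (incl x)
      then obtain k where "x = (q ^^ k) w" using X_funpow_q[OF w] by blast
      then show ?case using h_odd by metis
    next
      case (inv x)
      then obtain k where "inv x = (q ^^ k) w" using X_funpow_q[OF w inv_X] by blast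
      then show ?case using h_odd by metis
    next
      case (eng g1 g2)
      then show ?case using h_mult by metis
    qed
    then obtain k where "g = h k" ..
    also have "\<dots> = h (k mod (2 * int ?p))" by (simp add: h_eq cong_def)
    finally show "g \<in> h ` carrier ?Z" unfolding carZ using card_pos by auto
  qed (auto simp: h_def)
  ultimately have h: "h \<in> iso ?Z G" by (simp add: iso_def bij_betw_def)
  define f where "f = inv_into (carrier ?Z) h"
  have f: "f \<in> iso G ?Z" unfolding f_def by (rule Z.iso_set_sym[OF h])
  have inj: "inj_on h (carrier ?Z)" using h by (simp add: iso_def bij_betw_def)
  have fh: "f (h k) = k" if "k \<in> carrier ?Z" for k
    using that inj by (simp add: f_def)
  have step: "f (q ((q ^^ k) w)) = odd_cycle ?p (2 * int k + 1) \<and> f ((q ^^ k) w) = 2 * int k + 1 \<and>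
     2 * int k + 1 \<in> odd_residues ?p" if k: "k < ?p" for k
  proof -
    have mem: "2 * int k + 1 \<in> odd_residues ?p" using k by (simp add: odd_residues_def)
    \<comment> \<open>At k = p - 1 the cycle wraps around to 1; \<open>h\<close> does not see the
      reduction modulo 2 p.\<close>
    have "h (odd_cycle ?p (2 * int k + 1)) = h (2 * int (Suc k) + 1)"
      unfolding odd_cycle_eq[OF k] by (simp add: h_eq cong_def add.commute)
    then have "h (odd_cycle ?p (2 * int k + 1)) = q ((q ^^ k) w)"
      by (simp only: h_odd funpow.simps comp_apply)
    then show ?thesis
      using fh[OF Z.X_carrier[OF Z.q_X[OF mem]]] fh[OF Z.X_carrier[OF mem]] h_odd mem by simp
  qed
  have Xk: "\<exists>k<?p. x = (q ^^ k) w" if x: "x \<in> X" for x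
  proof -
    obtain k where "x = (q ^^ k) w" "k \<le> ?p - 1" using x X_funpow_q_less[OF w] by blast
    then show ?thesis using card_pos by (intro exI[of _ k]) auto
  qed
  have "f ` X = odd_residues ?p"
  proof (intro equalityI subsetI)
    fix y assume "y \<in> f ` X"
    then show "y \<in> odd_residues ?p" using Xk step by fastforce
  next
    fix y assume y: "y \<in> odd_residues ?p"
    then have "y = 2 * int (nat (y div 2)) + 1" "nat (y div 2) < ?p"
      by (auto simp: odd_residues_def elim!: oddE)
    then have "y = f ((q ^^ nat (y div 2)) w)" using step by metis
    then show "y \<in> f ` X" using funpow_q_X[OF w] by blast
  qed
  moreover have "odd_cycle ?p (f x) = f (q x)" if "x \<in> X" for x
    using Xk[OF that] step by auto
  ultimately show ?thesis
    using map_isomorphic_iso[OF f Z.group_axioms, of "odd_cycle ?p"] by simp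
qed

end

text \<open>The guard \<open>p \<noteq> 2\<close> stands before each description: the triangle is a
  regular map of valency 2 that is both balanced and anti-balanced and has neither form.\<close>

theorem theorem1p1:
  fixes G :: "('a, 'm) monoid_scheme" and X :: "'a set" and q :: "'a \<Rightarrow> 'a" and p :: nat
  assumes "prime p"
    and "comm_group G"
    and "finite (carrier G)"
    and "cayley_data G X q"
    and "card X = p"
    and "regular_map (cayley_map G X q)"
  shows "(balanced G X q \<or> anti_balanced G X q) \<and>
    (p \<noteq> 2 \<longrightarrow> balanced G X q \<longrightarrow>
      (\<exists>n X1 q1.
         cayley_data (Z2_pow n) X1 q1 \<and>
         map_isomorphic (cayley_map G X q) (cayley_map (Z2_pow n) X1 q1) \<and>
         (\<exists>A\<in>GL2 n. \<exists>x\<in>carrier_vec n.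
            X1 = {(A ^\<^sub>m i) *\<^sub>v x | i. i \<le> p - 1} \<and>
            A ^\<^sub>m p = 1\<^sub>m n \<and> (\<forall>k. 0 < k \<and> k < p \<longrightarrow> A ^\<^sub>m k \<noteq> 1\<^sub>m n) \<and>
            generate (Z2_pow n) {(A ^\<^sub>m i) *\<^sub>v x | i. i \<le> p - 1} = carrier (Z2_pow n) \<and>
            (\<forall>i \<le> p - 1. q1 ((A ^\<^sub>m i) *\<^sub>v x) = (A ^\<^sub>m (i + 1)) *\<^sub>v x)))) \<and>
    (p \<noteq> 2 \<longrightarrow> anti_balanced G X q \<longrightarrow>
      map_isomorphic (cayley_map G X q)
        (cayley_map (integer_mod_group (2 * p)) (odd_residues p) (odd_cycle p)))"
proof -
  interpret cayley_data G X q by (rule assms(4))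
  obtain \<phi> where "skew_cayley G X q \<phi>"
    using regular_map_skew[OF assms(6)] by blast
  then interpret prime_abelian_skew G X q \<phi>
    using assms(1,2,5) by (simp add: prime_abelian_skew_def prime_abelian_skew_axioms_def)
  show ?thesis
    using balanced_or_anti_balanced balanced_classification anti_balanced_classification
    unfolding assms(5) by blast
qed

end
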